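(* Let $n\geq2$, fix $p_0\in\mathbb{S}^n$ and let $\Psi:\mathbb{B}\to B$ be a patch of normal geodesic coordinates centered at $p_0$, where $\mathbb{B}$ is the geodesic ball of radius $1$ in $\mathbb{S}^n$ centered at $p_0$ and $B$ is the unit ball in $\mathbb{R}^n$ centered at the origin. Let $\phi:\mathbb{R}^n\to\mathbb{R}^m$ satisfy $\Delta\phi+\phi=0$ (componentwise). Fix a positive integer $r$ and a constant $\delta'>0$. Then for every sufficiently large integer $N$ there is an $\mathbb{R}^m$-valued eigenfunction $\psi$ of the Laplacian on $\mathbb{S}^n$ with eigenvalue $N(N+n-1)$ (i.e. $\Delta\psi=-N(N+n-1)\psi$ componentwise) such that \[\Big\|\phi-\psi\circ\Psi^{-1}\Big(\frac{\cdot}{N}\Big)\Big\|_{C^r(B)}\leq\delta'.\]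
   Context: $\mathbb{S}^n$ is the unit sphere in $\mathbb{R}^{n+1}$ with the round metric. *)

theory Defs
  imports "HOL-Analysis.Analysis"
begin

fun pd :: "'n::finite list \<Rightarrow> (real^'n \<Rightarrow> 'a::real_normed_vector) \<Rightarrow> real^'n \<Rightarrow> 'a" where
  "pd [] f = f"
| "pd (i # is) f = (\<lambda>x. frechet_derivative (pd is f) (at x) (axis i 1))"

definition smooth_on :: "(real^'n::finite) set \<Rightarrow> (real^'n \<Rightarrow> 'a::real_normed_vector) \<Rightarrow> bool" where
  "smooth_on S f \<longleftrightarrow> (\<forall>is. \<forall>x\<in>S. pd is f differentiable (at x))"

definition lap :: "(real^'n::finite \<Rightarrow> 'a::real_normed_vector) \<Rightarrow> real^'n \<Rightarrow> 'a" where
  "lap f x = (\<Sum>i\<in>UNIV. pd [i, i] f x)"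

(* Laplace-Beltrami operator on the unit sphere S^n in R^(n+1), computed via the
   degree-0 homogeneous extension x \<mapsto> f (x / |x|) *)
definition sphere_ext :: "(real^'k::finite \<Rightarrow> 'a) \<Rightarrow> real^'k \<Rightarrow> 'a" where
  "sphere_ext f x = f (x /\<^sub>R norm x)"

definition sphere_lap :: "(real^'k::finite \<Rightarrow> 'a::real_normed_vector) \<Rightarrow> real^'k \<Rightarrow> 'a" where
  "sphere_lap f p = lap (sphere_ext f) p"

definition sphere_eigenfunction :: "(real^'k::finite \<Rightarrow> 'a::real_normed_vector) \<Rightarrow> real \<Rightarrow> bool" where
  "sphere_eigenfunction f lam \<longleftrightarrow>
     smooth_on (UNIV - {0}) (sphere_ext f) \<and>
     (\<exists>p\<in>sphere 0 1. f p \<noteq> 0) \<and>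
     (\<forall>p\<in>sphere 0 1. sphere_lap f p = - lam *\<^sub>R f p)"

(* Normal geodesic coordinates on S^n centred at p0: the inverse chart Psi^{-1} is
   exp_{p0} composed with a linear isometry L from R^n onto the tangent space p0^perp *)
definition normal_coord_frame :: "real^'k::finite \<Rightarrow> (real^'n::finite \<Rightarrow> real^'k) \<Rightarrow> bool" where
  "normal_coord_frame p0 L \<longleftrightarrow> p0 \<in> sphere 0 1 \<and> linear L \<and>
     (\<forall>y. norm (L y) = norm y) \<and> (\<forall>y. L y \<bullet> p0 = 0)"

definition sphere_exp :: "real^'k::finite \<Rightarrow> real^'k \<Rightarrow> real^'k" where
  "sphere_exp p v = cos (norm v) *\<^sub>R p + (sin (norm v) / norm v) *\<^sub>R v"

definition normal_coord_inv :: "real^'k::finite \<Rightarrow> (real^'n::finite \<Rightarrow> real^'k) \<Rightarrow> real^'n \<Rightarrow> real^'k" where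
  "normal_coord_inv p0 L y = sphere_exp p0 (L y)"

definition Cr_norm :: "nat \<Rightarrow> (real^'n::finite) set \<Rightarrow> (real^'n \<Rightarrow> 'a::real_normed_vector) \<Rightarrow> real" where
  "Cr_norm r S f = (SUP ix \<in> {is. length is \<le> r} \<times> S. norm (pd (fst ix) f (snd ix)))"

end

theory Submission
  imports Defs
begin

text \<open>Write $P_k(y)$ for the $k$-th total derivative of $\phi$ at $0$ evaluated at $(y, \dots, y)$. The equation
  $\Delta\phi = -\phi$ gives $\Delta P_k = -k(k-1) P_{k-2}$, and therefore
  $\sum_{k \le N} \binom{N}{k} t^{N-k} P_k(y)$ is a harmonic polynomial in $(t, y)$, homogeneous of degree $N$;
  its restriction to the sphere is the eigenfunction. (For a plane wave $e^{i x \cdot \omega}$ it is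
  $(t + i y \cdot \omega)^N$.) At the point with normal coordinates $x/N$ one has $t = \cos(|x|/N)$ and
  $y = \sin(|x|/N) x/|x|$, so that the $k$-th summand tends to $P_k(x)/k!$, the $k$-th Taylor term of $\phi$.
  The limit can be taken under the sum, in $C^r$, because Helmholtz solutions have an everywhere convergent Taylor
  series. This follows from an interior gradient estimate on cubes of side of order $1/k$, iterated $k$ times.
  If $\phi(0) = 0$, a small multiple of $\cos x_i$ is added to $\phi$ to make sure that the eigenfunction is not zero.\<close>

section \<open>Iterated partial derivatives\<close>

text \<open>The scale 1/N is dictated by the eigenvalue: N(N+n-1) grows like N^2, so in the
  coordinates x/N the spherical equation tends to the flat one. The binomial weights are forced by
  harmonicity: t^(N-k) contributes (N-k)(N-k-1), P_(k+2) contributes (k+2)(k+1), and binomial(N,k)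
  balances the two. The obstacle is that the sum has N+1 terms whose factors are themselves powers
  of total degree N, so convergence of each term is not enough. The errors must be summable in k
  uniformly in N: in C^r on the unit ball the Taylor terms decay like 4^-k, the weights err by at
  most k^2/N, and the powers of cos s and sin s / s err by exp(\<kappa>/N) - 1, independently of k.
  The gradient estimate rests on the maximum principle, hence on first and second derivative tests
  along coordinate lines, without integration or a representation formula. Bounds in C^r are a
  relation \<open>Cr_le\<close> between a function and a number: no supremum has to be finite, and
  differentiability travels with the estimate.\<close>

declare pd.simps [simp del]

lemma pd_Nil [simp]: "pd [] f = f"
  by (simp add: pd.simps)

lemma pd_single: "pd [i] f x = frechet_derivative f (at x) (axis i 1)"
  by (simp add: pd.simps)

lemma pd_Cons: "pd (i # is) f = pd [i] (pd is f)"
  by (simp add: pd.simps)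

lemma pd_append: "pd (is @ js) f = pd is (pd js f)"
proof (induction "is")
  case (Cons i "is")
  then show ?case by (simp add: pd_Cons [of i "is @ js"] pd_Cons [of i "is"])
qed simp

lemma pd_has_derivative:
  assumes "(f has_derivative f') (at x)"
  shows "pd [i] f x = f' (axis i 1)"
  using frechet_derivative_at [OF assms] by (simp add: pd_single)

lemma has_derivative_pd:
  fixes f :: "real^'n::finite \<Rightarrow> 'a::real_normed_vector"
  assumes "f differentiable (at x)"
  shows "(f has_derivative (\<lambda>h. \<Sum>i\<in>UNIV. h $ i *\<^sub>R pd [i] f x)) (at x)"
proof -
  let ?D = "frechet_derivative f (at x)"
  have D: "(f has_derivative ?D) (at x)"
    using assms frechet_derivative_works by blast
  then have "linear ?D"
    by (rule has_derivative_linear)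
  then have "?D h = (\<Sum>i\<in>UNIV. h $ i *\<^sub>R pd [i] f x)" for h
    by (subst basis_expansion [of h, symmetric])
       (simp add: linear_sum linear_cmul pd_single scalar_mult_eq_scaleR)
  then show ?thesis using D by (metis (no_types, lifting) ext)
qed

lemma differentiable_cong_open:
  assumes "open S" "x \<in> S" "\<And>y. y \<in> S \<Longrightarrow> f y = g y" "f differentiable (at x)"
  shows "g differentiable (at x)"
  using assms has_derivative_transform_within_open unfolding differentiable_def by blast

lemma pd_cong:
  assumes "open S" "\<And>y. y \<in> S \<Longrightarrow> f y = g y" "x \<in> S"
  shows "pd is f x = pd is g x"
  using assms(3)
proof (induction "is" arbitrary: x)
  case (Cons i "is")
  have "frechet_derivative (pd is f) (at x) = frechet_derivative (pd is g) (at x)"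
  proof (cases "pd is f differentiable (at x)")
    case True
    then show ?thesis
      using frechet_derivative_transform_within_open [of "pd is f" x S "pd is g"] Cons assms(1) by blast
  next
    \<comment> \<open>\<open>frechet_derivative\<close> is a choice operator: where neither function
      is differentiable, both choices are made from the same empty predicate, so the two values
      still agree.\<close>
    case False
    then have "\<not> pd is g differentiable (at x)"
      using differentiable_cong_open [OF assms(1) Cons.prems, of "pd is g" "pd is f"] Cons.IH by auto
    then show ?thesis
      using False unfolding frechet_derivative_def differentiable_def by metis
  qed
  then show ?case by (simp add: pd.simps)
qed (use assms in auto)

lemma smooth_on_pd: "smooth_on S f \<Longrightarrow> smooth_on S (pd is f)"
  by (simp add: smooth_on_def flip: pd_append)

lemma smooth_on_imp_differentiable: "smooth_on S f \<Longrightarrow> x \<in> S \<Longrightarrow> f differentiable (at x)"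
  unfolding smooth_on_def by (metis pd_Nil)

lemma smooth_on_subset: "smooth_on S f \<Longrightarrow> T \<subseteq> S \<Longrightarrow> smooth_on T f"
  unfolding smooth_on_def by blast

lemma continuous_on_pd: "smooth_on S f \<Longrightarrow> continuous_on S (pd is f)"
  unfolding smooth_on_def
  by (meson continuous_at_imp_continuous_on differentiable_imp_continuous_within)

text \<open>\<open>smooth_on\<close> quantifies over words of derivatives, and the product rule
  turns one word into many. Counting only the order and peeling off the innermost derivative gives
  inductions in which \<open>f\<close> varies freely, so closure properties need just the
  first-order rules.\<close>

primrec diffk :: "nat \<Rightarrow> (real^'n::finite) set \<Rightarrow> (real^'n \<Rightarrow> 'a::real_normed_vector) \<Rightarrow> bool" where
  "diffk 0 S f = True"
| "diffk (Suc k) S f = ((\<forall>x\<in>S. f differentiable (at x)) \<and> (\<forall>i. diffk k S (pd [i] f)))"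

lemma diffk_imp_pd_differentiable:
  "diffk k S f \<Longrightarrow> length is < k \<Longrightarrow> x \<in> S \<Longrightarrow> pd is f differentiable (at x)"
proof (induction k arbitrary: f "is")
  case (Suc k)
  show ?case
  proof (cases "is" rule: rev_cases)
    case Nil
    then show ?thesis using Suc by simp
  next
    case (snoc js j)
    then show ?thesis using Suc by (simp add: pd_append)
  qed
qed simp

lemma smooth_on_imp_diffk: "smooth_on S f \<Longrightarrow> diffk k S f"
  by (induction k arbitrary: f) (auto intro: smooth_on_pd smooth_on_imp_differentiable)

lemma smooth_on_iff_diffk: "smooth_on S f \<longleftrightarrow> (\<forall>k. diffk k S f)"
  using smooth_on_imp_diffk diffk_imp_pd_differentiable
  by (metis lessI smooth_on_def)

lemma diffk_cong:
  assumes "open S" "\<And>y. y \<in> S \<Longrightarrow> f y = g y" "diffk k S f"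
  shows "diffk k S g"
  using assms(2,3)
proof (induction k arbitrary: f g)
  case (Suc k)
  show ?case
    unfolding diffk.simps
  proof (intro conjI ballI allI)
    fix x assume "x \<in> S"
    then show "g differentiable (at x)"
      using differentiable_cong_open [OF assms(1)] Suc.prems by (metis diffk.simps(2))
  next
    fix i
    show "diffk k S (pd [i] g)"
    proof (rule Suc.IH)
      show "pd [i] f y = pd [i] g y" if "y \<in> S" for y
        using assms(1) Suc.prems(1) that by (rule pd_cong)
      show "diffk k S (pd [i] f)"
        using Suc.prems(2) by simp
    qed
  qed
qed simp

lemma diffk_Suc_imp: "diffk (Suc k) S f \<Longrightarrow> diffk k S f"
  by (induction k arbitrary: f) auto

section \<open>Sum, product and linearity rules; closure of smoothness\<close>

lemma pd_const [simp]: "pd [i] (\<lambda>x. c) = (\<lambda>x. 0)"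
  by (auto simp: pd_single)

lemma pd_linear:
  "bounded_linear T \<Longrightarrow> pd [i] T = (\<lambda>x. T (axis i 1))"
  by (intro ext pd_has_derivative bounded_linear_imp_has_derivative)

lemma pd_add:
  assumes "f differentiable (at x)" "g differentiable (at x)"
  shows "pd [i] (\<lambda>x. f x + g x) x = pd [i] f x + pd [i] g x"
  using assms has_derivative_add unfolding pd_single
  by (intro pd_has_derivative [unfolded pd_single, THEN trans]) (auto simp: frechet_derivative_works)

lemma pd_mult:
  fixes f g :: "real^'n::finite \<Rightarrow> real"
  assumes "f differentiable (at x)" "g differentiable (at x)"
  shows "pd [i] (\<lambda>x. f x * g x) x = pd [i] f x * g x + f x * pd [i] g x"
  using pd_has_derivative [OF has_derivative_mult [OF assms [THEN iffD1 [OF frechet_derivative_works]]]]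
  by (simp add: pd_single algebra_simps)

lemma pd_compose_linear:
  assumes "bounded_linear T" "f differentiable (at x)"
  shows "pd [i] (\<lambda>x. T (f x)) x = T (pd [i] f x)"
  using pd_has_derivative [OF bounded_linear.has_derivative [OF assms(1) assms(2) [THEN iffD1 [OF frechet_derivative_works]]]]
  by (simp add: pd_single)


lemma diffk_add:
  assumes "open S" "diffk k S f" "diffk k S g"
  shows "diffk k S (\<lambda>x. f x + g x)"
  using assms(2,3)
proof (induction k arbitrary: f g)
  case (Suc k)
  have "diffk k S (pd [i] (\<lambda>x. f x + g x))" for i
    by (rule diffk_cong [OF assms(1) pd_add [symmetric]]) (use Suc in auto)
  then show ?case using Suc.prems by (auto intro: differentiable_add)
qed simp

lemma diffk_mult:
  fixes f g :: "real^'n::finite \<Rightarrow> real"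
  assumes "open S" "diffk k S f" "diffk k S g"
  shows "diffk k S (\<lambda>x. f x * g x)"
  using assms(2,3)
proof (induction k arbitrary: f g)
  case (Suc k)
  have "diffk k S (pd [i] (\<lambda>x. f x * g x))" for i
  proof (rule diffk_cong [OF assms(1) pd_mult [symmetric]])
    have "diffk k S (\<lambda>x. pd [i] f x * g x)" "diffk k S (\<lambda>x. f x * pd [i] g x)"
      using Suc.prems diffk_Suc_imp by (auto intro!: Suc.IH)
    then show "diffk k S (\<lambda>x. pd [i] f x * g x + f x * pd [i] g x)"
      using diffk_add assms(1) by blast
  qed (use Suc.prems in auto)
  then show ?case using Suc.prems by (auto intro: differentiable_mult)
qed simp

lemma diffk_compose_linear:
  assumes "bounded_linear T" "open S" "diffk k S f"
  shows "diffk k S (\<lambda>x. T (f x))"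
  using assms(3)
proof (induction k arbitrary: f)
  case (Suc k)
  have "diffk k S (pd [i] (\<lambda>x. T (f x)))" for i
    by (rule diffk_cong [OF assms(2) pd_compose_linear [OF assms(1), symmetric]]) (use Suc in auto)
  moreover have "(\<lambda>x. T (f x)) differentiable (at x)" if "x \<in> S" for x
    using that Suc.prems bounded_linear.has_derivative [OF assms(1)]
    unfolding differentiable_def diffk.simps by blast
  ultimately show ?case by simp
qed simp

lemma smooth_on_const: "smooth_on S (\<lambda>x. c)"
proof -
  have "diffk k S (\<lambda>x. c)" for k
    by (induction k arbitrary: c) auto
  then show ?thesis by (simp add: smooth_on_iff_diffk)
qed

lemma smooth_on_linear: "bounded_linear T \<Longrightarrow> smooth_on S T"
proof -
  assume T: "bounded_linear T"
  have "diffk k S T" for k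
  proof (cases k)
    case (Suc l)
    then show ?thesis
      using T smooth_on_imp_diffk [OF smooth_on_const]
      by (auto simp: pd_linear intro: bounded_linear_imp_differentiable)
  qed simp
  then show ?thesis by (simp add: smooth_on_iff_diffk)
qed

lemma smooth_on_add:
  "open S \<Longrightarrow> smooth_on S f \<Longrightarrow> smooth_on S g \<Longrightarrow> smooth_on S (\<lambda>x. f x + g x)"
  by (simp add: smooth_on_iff_diffk diffk_add)

lemma smooth_on_mult:
  fixes f g :: "real^'n::finite \<Rightarrow> real"
  shows "open S \<Longrightarrow> smooth_on S f \<Longrightarrow> smooth_on S g \<Longrightarrow> smooth_on S (\<lambda>x. f x * g x)"
  by (simp add: smooth_on_iff_diffk diffk_mult)

lemma smooth_on_compose_linear:
  "bounded_linear T \<Longrightarrow> open S \<Longrightarrow> smooth_on S f \<Longrightarrow> smooth_on S (\<lambda>x. T (f x))"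
  by (simp add: smooth_on_iff_diffk diffk_compose_linear)

lemma smooth_on_sum:
  assumes "open S" "\<And>a. a \<in> A \<Longrightarrow> smooth_on S (f a)"
  shows "smooth_on S (\<lambda>x. \<Sum>a\<in>A. f a x)"
  using assms(2)
  by (induction A rule: infinite_finite_induct) (auto intro: smooth_on_const smooth_on_add assms(1))

lemma smooth_on_power:
  fixes f :: "real^'n::finite \<Rightarrow> real"
  shows "open S \<Longrightarrow> smooth_on S f \<Longrightarrow> smooth_on S (\<lambda>x. f x ^ k)"
  by (induction k) (auto intro: smooth_on_const smooth_on_mult)

lemma smooth_on_diff:
  "open S \<Longrightarrow> smooth_on S f \<Longrightarrow> smooth_on S g \<Longrightarrow> smooth_on S (\<lambda>x. f x - g x)"
  using smooth_on_add [of S f "\<lambda>x. - g x"]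
    smooth_on_compose_linear [OF bounded_linear_minus [OF bounded_linear_ident], of S g] by simp

lemma pd_list_add:
  assumes "open S" "smooth_on S f" "smooth_on S g" "x \<in> S"
  shows "pd is (\<lambda>x. f x + g x) x = pd is f x + pd is g x"
  using assms(4)
proof (induction "is" arbitrary: x)
  case (Cons i "is")
  have "pd (i # is) (\<lambda>x. f x + g x) x = pd [i] (\<lambda>x. pd is f x + pd is g x) x"
    using pd_cong [OF assms(1) Cons.IH Cons.prems] by (simp add: pd_Cons [of i "is"])
  also have "\<dots> = pd (i # is) f x + pd (i # is) g x"
    using assms(2,3) Cons.prems
    by (subst pd_add) (auto simp: pd_Cons [of i "is"] smooth_on_def)
  finally show ?case .
qed simp

lemma pd_list_compose_linear:
  assumes "bounded_linear T" "open S" "smooth_on S f" "x \<in> S"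
  shows "pd is (\<lambda>x. T (f x)) x = T (pd is f x)"
  using assms(4)
proof (induction "is" arbitrary: x)
  case (Cons i "is")
  have "pd (i # is) (\<lambda>x. T (f x)) x = pd [i] (\<lambda>x. T (pd is f x)) x"
    using pd_cong [OF assms(2) Cons.IH Cons.prems] by (simp add: pd_Cons [of i "is"])
  also have "\<dots> = T (pd (i # is) f x)"
    using assms(3) Cons.prems
    by (subst pd_compose_linear [OF assms(1)]) (auto simp: pd_Cons [of i "is"] smooth_on_def)
  finally show ?case .
qed simp

lemma pd_list_sum:
  assumes "open S" "\<And>a. a \<in> A \<Longrightarrow> smooth_on S (f a)" "x \<in> S"
  shows "pd is (\<lambda>x. \<Sum>a\<in>A. f a x) x = (\<Sum>a\<in>A. pd is (f a) x)"
  using assms(2)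
proof (induction A rule: infinite_finite_induct)
  case (insert a A)
  then show ?case
    using pd_list_add [OF assms(1) _ _ assms(3), of "f a" "\<lambda>x. \<Sum>a\<in>A. f a x"]
      smooth_on_sum [OF assms(1), of A f] by simp
qed (use pd_list_compose_linear [OF bounded_linear_zero assms(1) smooth_on_const assms(3)] in simp_all)

section \<open>Restriction to lines and symmetry of mixed derivatives\<close>

lemma has_real_derivative_line:
  fixes f :: "real^'n::finite \<Rightarrow> real"
  assumes "f differentiable (at (x + s *\<^sub>R v))"
  shows "((\<lambda>s. f (x + s *\<^sub>R v)) has_real_derivative (\<Sum>i\<in>UNIV. v $ i * pd [i] f (x + s *\<^sub>R v))) (at s)"
proof -
  have "((\<lambda>s. x + s *\<^sub>R v) has_derivative (\<lambda>h. h *\<^sub>R v)) (at s)"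
    by (auto intro!: derivative_eq_intros)
  from diff_chain_at [OF this has_derivative_pd [OF assms]] show ?thesis
    unfolding has_field_derivative_def o_def
    by (rule has_derivative_eq_rhs) (auto simp: sum_distrib_left sum_distrib_right mult_ac)
qed

lemma has_real_derivative_axis:
  fixes f :: "real^'n::finite \<Rightarrow> real"
  assumes "f differentiable (at (x + s *\<^sub>R axis i 1))"
  shows "((\<lambda>s. f (x + s *\<^sub>R axis i 1)) has_real_derivative pd [i] f (x + s *\<^sub>R axis i 1)) (at s)"
proof -
  have "(\<Sum>j\<in>UNIV. axis i 1 $ j * pd [j] f y) = pd [i] f y" for y
    by (simp add: axis_def if_distrib [of "\<lambda>x. x * _"] cong: if_cong)
  then show ?thesis using has_real_derivative_line [OF assms] by simp
qed

text \<open>The mean value theorem is applied twice, first in direction i to the difference of two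
  parallel segments, then in direction j. The left side is symmetric in i and j, while the right
  side shows one particular order of differentiation.\<close>

lemma second_difference:
  fixes f :: "real^'n::finite \<Rightarrow> real"
  assumes f: "smooth_on UNIV f" and "h > 0"
  shows "\<exists>a b. 0 < a \<and> a < h \<and> 0 < b \<and> b < h \<and>
    f (x + h *\<^sub>R axis i 1 + h *\<^sub>R axis j 1) - f (x + h *\<^sub>R axis i 1) - f (x + h *\<^sub>R axis j 1) + f x
      = h * (h * pd [j, i] f (x + a *\<^sub>R axis i 1 + b *\<^sub>R axis j 1))"
proof -
  have df: "pd is f differentiable (at y)" for "is" y
    using f by (simp add: smooth_on_def)
  let ?g = "\<lambda>s. f (x + h *\<^sub>R axis j 1 + s *\<^sub>R axis i 1) - f (x + s *\<^sub>R axis i 1)"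
  let ?g' = "\<lambda>s. pd [i] f (x + h *\<^sub>R axis j 1 + s *\<^sub>R axis i 1) - pd [i] f (x + s *\<^sub>R axis i 1)"
  have "DERIV ?g s :> ?g' s" for s
    using df [of "[]"] by (intro DERIV_diff has_real_derivative_axis) auto
  from MVT2 [OF \<open>h > 0\<close> this] obtain a where a: "0 < a" "a < h" "?g h - ?g 0 = h * ?g' a"
    by auto
  let ?k = "\<lambda>s. pd [i] f (x + a *\<^sub>R axis i 1 + s *\<^sub>R axis j 1)"
  have "DERIV ?k s :> pd [j] (pd [i] f) (x + a *\<^sub>R axis i 1 + s *\<^sub>R axis j 1)" for s
    using df by (intro has_real_derivative_axis) auto
  from MVT2 [OF \<open>h > 0\<close> this] obtain b where "0 < b" "b < h"
    "?k h - ?k 0 = h * pd [j] (pd [i] f) (x + a *\<^sub>R axis i 1 + b *\<^sub>R axis j 1)"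
    by auto
  with a show ?thesis
    by (intro exI [of _ a] exI [of _ b]) (simp add: pd_Cons [of j "[i]"] algebra_simps)
qed

text \<open>Expanding the same second difference in both orders makes the two mixed derivatives
  equal at two points within a shrinking distance of x; continuity of both derivatives then gives
  equality at x.\<close>

lemma pd_commute:
  fixes f :: "real^'n::finite \<Rightarrow> real"
  assumes f: "smooth_on UNIV f"
  shows "pd [i] (pd [j] f) = pd [j] (pd [i] f)"
proof
  fix x
  have cont: "isCont (pd is f) x" for "is"
    using f by (simp add: smooth_on_def differentiable_imp_continuous_within)
  let ?w = "\<lambda>i j a b k. x + a (k::nat) *\<^sub>R axis i 1 + b k *\<^sub>R (axis j 1 :: real^'n)"
  have lim: "(\<lambda>k. pd is f (?w i j a b k)) \<longlonglongrightarrow> pd is f x"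
    if "\<And>k. 0 < a k \<and> a k < 1 / Suc k" "\<And>k. 0 < b k \<and> b k < 1 / Suc k" for a b :: "nat \<Rightarrow> real" and i j "is"
  proof -
    have z: "c \<longlonglongrightarrow> 0" if "\<And>k. 0 < c k \<and> c k < 1 / Suc k" for c :: "nat \<Rightarrow> real"
      by (rule tendsto_sandwich [OF _ _ tendsto_const LIMSEQ_inverse_real_of_nat])
         (use that in \<open>auto intro!: always_eventually less_imp_le simp: field_simps\<close>)
    have "?w i j a b \<longlonglongrightarrow> x + 0 *\<^sub>R axis i 1 + 0 *\<^sub>R axis j 1"
      by (intro tendsto_intros z that)
    then show ?thesis
      using isCont_tendsto_compose [OF cont] by simp
  qed
  have "\<exists>a b. 0 < a \<and> a < 1 / Suc k \<and> 0 < b \<and> b < 1 / Suc k \<and>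
      (\<exists>c d. 0 < c \<and> c < 1 / Suc k \<and> 0 < d \<and> d < 1 / Suc k \<and>
        pd [i, j] f (x + a *\<^sub>R axis j 1 + b *\<^sub>R axis i 1) = pd [j, i] f (x + c *\<^sub>R axis i 1 + d *\<^sub>R axis j 1))" for k :: nat
  proof -
    let ?h = "1 / real (Suc k)"
    have h: "?h > 0" by simp
    from second_difference [OF f h, of x j i] obtain a b where ab: "0 < a" "a < ?h" "0 < b" "b < ?h"
      "f (x + ?h *\<^sub>R axis j 1 + ?h *\<^sub>R axis i 1) - f (x + ?h *\<^sub>R axis j 1) - f (x + ?h *\<^sub>R axis i 1) + f x
      = ?h * (?h * pd [i, j] f (x + a *\<^sub>R axis j 1 + b *\<^sub>R axis i 1))" by blast
    from second_difference [OF f h, of x i j] obtain c d where cd: "0 < c" "c < ?h" "0 < d" "d < ?h"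
      "f (x + ?h *\<^sub>R axis i 1 + ?h *\<^sub>R axis j 1) - f (x + ?h *\<^sub>R axis i 1) - f (x + ?h *\<^sub>R axis j 1) + f x
      = ?h * (?h * pd [j, i] f (x + c *\<^sub>R axis i 1 + d *\<^sub>R axis j 1))" by blast
    have "?h * (?h * pd [i, j] f (x + a *\<^sub>R axis j 1 + b *\<^sub>R axis i 1)) = ?h * (?h * pd [j, i] f (x + c *\<^sub>R axis i 1 + d *\<^sub>R axis j 1))"
      unfolding ab(5) [symmetric] cd(5) [symmetric] by (simp add: add_ac)
    then have "pd [i, j] f (x + a *\<^sub>R axis j 1 + b *\<^sub>R axis i 1) = pd [j, i] f (x + c *\<^sub>R axis i 1 + d *\<^sub>R axis j 1)"
      using h by simp
    with ab(1-4) cd(1-4) show ?thesis by blast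
  qed
  then obtain a b c d where ab: "\<And>k. 0 < a k \<and> a k < 1 / Suc k" "\<And>k. 0 < b k \<and> b k < 1 / Suc k"
    and cd: "\<And>k. 0 < c k \<and> c k < 1 / Suc k" "\<And>k. 0 < d k \<and> d k < 1 / Suc k"
    and eq: "\<And>k. pd [i, j] f (?w j i a b k) = pd [j, i] f (?w i j c d k)"
    by metis
  have "pd [i, j] f x = pd [j, i] f x"
    using lim [OF ab, of "[i, j]" j i] lim [OF cd, of "[j, i]" i j] LIMSEQ_unique unfolding eq by blast
  then show "pd [i] (pd [j] f) x = pd [j] (pd [i] f) x"
    by (simp add: pd_Cons [of _ "[_]"])
qed

section \<open>Interior derivative estimates for the Helmholtz equation\<close>

definition helmholtz :: "(real^'n::finite \<Rightarrow> real) \<Rightarrow> bool" where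
  "helmholtz u \<longleftrightarrow> smooth_on UNIV u \<and> (\<forall>x. lap u x = - u x)"

lemma pd_uminus_fun: "smooth_on UNIV f \<Longrightarrow> pd is (\<lambda>x. - f x) = (\<lambda>x. - pd is f x)"
  using pd_list_compose_linear [OF bounded_linear_minus [OF bounded_linear_ident] open_UNIV]
  by auto

text \<open>The Laplacian has constant coefficients, so symmetry of mixed derivatives lets it pass
  through \<open>pd [i]\<close>. This is what allows the gradient estimate to be iterated.\<close>

lemma helmholtz_pd_single:
  assumes "helmholtz u"
  shows "helmholtz (pd [i] u)"
proof -
  have u: "smooth_on UNIV u" and eq: "(\<lambda>x. \<Sum>j\<in>UNIV. pd [j, j] u x) = (\<lambda>x. - u x)"
    using assms by (auto simp: helmholtz_def lap_def)
  have "pd [j, j] (pd [i] u) = pd [i] (pd [j, j] u)" for j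
    using pd_commute [OF u, of i j] pd_commute [OF smooth_on_pd [OF u], of i j "[j]"]
    by (simp add: pd_Cons [of j "[j]"])
  then have "lap (pd [i] u) x = (\<Sum>j\<in>UNIV. pd [i] (pd [j, j] u) x)" for x
    by (simp add: lap_def)
  also have "\<dots> x = pd [i] (\<lambda>x. \<Sum>j\<in>UNIV. pd [j, j] u x) x" for x
    by (subst pd_list_sum [OF open_UNIV]) (auto intro: smooth_on_pd u)
  also have "\<dots> x = - pd [i] u x" for x
    unfolding eq using pd_uminus_fun [OF u] by metis
  finally show ?thesis
    using u by (simp add: helmholtz_def smooth_on_pd)
qed

lemma helmholtz_pd: "helmholtz u \<Longrightarrow> helmholtz (pd is u)"
proof (induction "is")
  case (Cons i "is")
  then show ?case by (subst pd_Cons) (simp add: helmholtz_pd_single)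
qed simp

text \<open>If D were positive, then from g' 0 = 0 the slope would be positive just to the right of
  0, and the mean value theorem would push g above g 0.\<close>

lemma second_derivative_local_max:
  fixes g g' :: "real \<Rightarrow> real"
  assumes "d > 0" and g: "\<And>s. \<bar>s\<bar> < d \<Longrightarrow> DERIV g s :> g' s" and g': "DERIV g' 0 :> D"
    and max: "\<And>s. \<bar>s\<bar> < d \<Longrightarrow> g s \<le> g 0"
  shows "D \<le> 0"
proof (rule ccontr)
  assume "\<not> D \<le> 0"
  then obtain e where e: "e > 0" "\<And>h. h > 0 \<Longrightarrow> h < e \<Longrightarrow> g' 0 < g' h"
    using DERIV_pos_inc_right [OF g'] by auto
  have "g' 0 = 0"
    using DERIV_local_max [OF g [of 0] \<open>d > 0\<close>] max \<open>d > 0\<close> by auto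
  define h where "h = min d e / 2"
  have h: "0 < h" "h < d" "h < e"
    using \<open>d > 0\<close> \<open>e > 0\<close> by (auto simp: h_def)
  have "\<exists>z>0. z < h \<and> g h - g 0 = (h - 0) * g' z"
    using h by (intro MVT2 g) auto
  then obtain z where "0 < z" "z < h" "g h - g 0 = h * g' z"
    by auto
  moreover have "h * g' z > 0"
    using e(2) [of z] \<open>g' 0 = 0\<close> h calculation by simp
  ultimately show False
    using max [of h] h by simp
qed

text \<open>The odd part of the solution in the direction of the derivative is compared, on half of the cube,
  with a quadratic barrier that vanishes at the centre (Gilbarg--Trudinger, Section 3.4).\<close>

lemma helmholtz_gradient_upper:
  fixes u :: "real^'n::finite \<Rightarrow> real" and d M :: real
  assumes u: "helmholtz u" and "d > 0" "M > 0"
    and bound: "\<And>y. (\<And>a. \<bar>y $ a - x $ a\<bar> \<le> d) \<Longrightarrow> \<bar>u y\<bar> \<le> M"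
  shows "pd [j] u x \<le> (CARD('n) / d + d) * M"
proof -
  let ?n = "real CARD('n)"
  have n: "?n \<ge> 1"
    by (simp add: Suc_leI)
  have smooth: "smooth_on UNIV u" and lap: "\<And>y. lap u y = - u y"
    using u by (auto simp: helmholtz_def)
  have du: "pd is u differentiable (at y)" for "is" y
    using smooth by (simp add: smooth_on_def)
  have D1: "DERIV (\<lambda>s. u (y + s *\<^sub>R axis a 1)) s :> pd [a] u (y + s *\<^sub>R axis a 1)" for a y s
    using du [of "[]"] by (intro has_real_derivative_axis) auto
  have D2: "DERIV (\<lambda>s. pd [a] u (y + s *\<^sub>R axis a 1)) s :> pd [a, a] u (y + s *\<^sub>R axis a 1)" for a y s
    using du by (subst pd_Cons) (intro has_real_derivative_axis)
  \<comment> \<open>Two demands fix the coefficients. The A sum to -M, so the Laplacian of q is -2M,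
    which outweighs the odd part (at most M) that the equation produces. On every outer face the
    term of that coordinate equals M; for the face in direction j this determines B j, the bound to
    be proved.\<close>
  define A where "A = (\<lambda>a. if a = j then - ((?n - 1) * M / d\<^sup>2 + M) else M / d\<^sup>2)"
  define B where "B = (\<lambda>a. if a = j then (?n / d + d) * M else 0)"
  define q where "q = (\<lambda>y::real^'n. \<Sum>a\<in>UNIV. A a * (y $ a - x $ a)\<^sup>2 + B a * (y $ a - x $ a))"
  \<comment> \<open>Reflection in the hyperplane through x orthogonal to axis j; \<open>F\<close> is
    the odd part under it minus the barrier.\<close>
  define \<sigma> where "\<sigma> = (\<lambda>y::real^'n. y - (2 * (y $ j - x $ j)) *\<^sub>R axis j 1)"
  define F where "F = (\<lambda>y. (u y - u (\<sigma> y)) / 2 - q y)"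
  define K where "K = cbox (\<chi> a. if a = j then x $ a else x $ a - d) (\<chi> a. x $ a + d)"
  have K: "y \<in> K \<longleftrightarrow> (\<forall>a. \<bar>y $ a - x $ a\<bar> \<le> d) \<and> x $ j \<le> y $ j" for y
  proof -
    have "y \<in> K \<longleftrightarrow> (\<forall>a. (if a = j then x $ a else x $ a - d) \<le> y $ a \<and> y $ a \<le> x $ a + d)"
      by (simp add: K_def mem_box_cart)
    also have "\<dots> \<longleftrightarrow> (\<forall>a. \<bar>y $ a - x $ a\<bar> \<le> d \<and> (a = j \<longrightarrow> x $ a \<le> y $ a))"
      by (rule all_cong1) (use \<open>d > 0\<close> in auto)
    finally show ?thesis by blast
  qed
  have sumA: "sum A UNIV = - M"
  proof -
    have "sum A UNIV = A j + sum A (UNIV - {j})"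
      by (simp add: sum.remove)
    also have "sum A (UNIV - {j}) = (\<Sum>a\<in>UNIV - {j}. M / d\<^sup>2)"
      by (rule sum.cong) (auto simp: A_def)
    also have "\<dots> = (?n - 1) * M / d\<^sup>2"
      using n by (simp add: card_Diff_singleton of_nat_diff)
    finally show ?thesis by (simp add: A_def)
  qed
  have \<sigma>_nth: "\<sigma> y $ a - x $ a = (if a = j then - (y $ a - x $ a) else y $ a - x $ a)" for y a
    by (simp add: \<sigma>_def axis_def)
  have \<sigma>_cube: "\<bar>\<sigma> y $ a - x $ a\<bar> \<le> d" if "y \<in> K" for y a
  proof -
    have "\<bar>\<sigma> y $ a - x $ a\<bar> = \<bar>y $ a - x $ a\<bar>"
      by (cases "a = j") (simp_all only: \<sigma>_nth if_True if_False abs_minus_cancel simp_thms)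
    then show ?thesis using that K by simp
  qed
  have uK: "\<bar>u y\<bar> \<le> M" "\<bar>u (\<sigma> y)\<bar> \<le> M" if "y \<in> K" for y
    using that \<sigma>_cube [OF that] K [of y] by (auto intro!: bound simp del: abs_le_iff)
  \<comment> \<open>Nonnegativity is needed term by term: q then dominates each single summand, in
    particular the one that equals M on a given face.\<close>
  have q_nonneg: "0 \<le> A a * (y $ a - x $ a)\<^sup>2 + B a * (y $ a - x $ a)" if "y \<in> K" for y a
  proof (cases "a = j")
    case True
    define t where "t = y $ j - x $ j"
    have t: "0 \<le> t" "t \<le> d"
      using that K [of y] unfolding t_def by (meson abs_le_D1 diff_ge_0_iff_ge)+
    have "A j * t\<^sup>2 + B j * t = M * t * ((?n * d - (?n - 1) * t) / d\<^sup>2 + (d - t))"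
      using \<open>d > 0\<close> by (simp add: A_def B_def field_simps power2_eq_square)
    moreover have "(?n - 1) * t \<le> ?n * d"
      using t n by (intro mult_mono) auto
    ultimately show ?thesis
      using t \<open>M > 0\<close> True by (simp add: t_def)
  next
    case False
    then show ?thesis using \<open>M > 0\<close> by (simp add: A_def B_def)
  qed
  have q_ge: "q y \<ge> A a * (y $ a - x $ a)\<^sup>2 + B a * (y $ a - x $ a)" if "y \<in> K" for y a
    unfolding q_def
    by (rule member_le_sum [of a UNIV "\<lambda>a. A a * (y $ a - x $ a)\<^sup>2 + B a * (y $ a - x $ a)"])
       (use q_nonneg that in auto)
  have F_le: "F y \<le> 0" if yK: "y \<in> K" for y
  proof -
    have "continuous_on UNIV u"
      using continuous_on_pd [OF smooth, of "[]"] by simp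
    moreover have "continuous_on UNIV \<sigma>"
      unfolding \<sigma>_def by (intro continuous_intros)
    ultimately have "continuous_on UNIV (\<lambda>y. u (\<sigma> y))"
      by (rule continuous_on_compose2) auto
    then have "continuous_on UNIV F"
      unfolding F_def q_def using \<open>continuous_on UNIV u\<close> by (intro continuous_intros) auto
    then have "continuous_on K F"
      using continuous_on_subset by blast
    moreover have "compact K" unfolding K_def by (rule compact_cbox)
    ultimately obtain y where y: "y \<in> K" and max: "\<And>z. z \<in> K \<Longrightarrow> F z \<le> F y"
      using continuous_attains_sup [of K F] yK by blast
    have "F y \<le> 0"
    proof (rule ccontr)
      assume "\<not> F y \<le> 0"
      then have pos: "F y > 0" by simp
      \<comment> \<open>A positive maximum lies in the interior of K: the odd part vanishes on the
        face through x, and q is at least M on all other faces.\<close>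
      have qy: "q y < M" "y $ j \<noteq> x $ j"
      proof -
        show "q y < M"
          using pos uK [OF y] unfolding F_def by (auto simp: abs_le_iff)
        show "y $ j \<noteq> x $ j"
        proof
          assume "y $ j = x $ j"
          then have "\<sigma> y = y" by (simp add: \<sigma>_def)
          moreover have "q y \<ge> 0"
            using q_ge [OF y, of j] q_nonneg [OF y, of j] by simp
          ultimately show False using pos by (simp add: F_def)
        qed
      qed
      have strict: "\<bar>y $ a - x $ a\<bar> < d" for a
      proof (rule ccontr)
        assume "\<not> \<bar>y $ a - x $ a\<bar> < d"
        then have e: "\<bar>y $ a - x $ a\<bar> = d"
          using y K [of y] by (auto intro: antisym dest: spec [of _ a])
        have "A a * (y $ a - x $ a)\<^sup>2 + B a * (y $ a - x $ a) = M"
        proof (cases "a = j")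
          case True
          then have "y $ a - x $ a = d"
            using e y K [of y] by auto
          then show ?thesis
            using \<open>d > 0\<close> True by (simp add: A_def B_def field_simps power2_eq_square)
        next
          case False
          have "(y $ a - x $ a)\<^sup>2 = d\<^sup>2"
            using e by (metis power2_abs)
          then show ?thesis using False \<open>d > 0\<close> by (simp add: A_def B_def)
        qed
        then show False using q_ge [OF y, of a] qy by simp
      qed
      have "(pd [a, a] u y - pd [a, a] u (\<sigma> y)) / 2 - 2 * A a \<le> 0" for a
      proof -
        \<comment> \<open>The sign with which the reflection acts on direction a. It enters the
          first derivative once and the second derivative squared, where it disappears.\<close>
        define \<kappa> :: real where "\<kappa> = (if a = j then -1 else 1)"
        have \<kappa>: "\<kappa> * \<kappa> = 1" by (simp add: \<kappa>_def)
        have \<sigma>_line: "\<sigma> (y + s *\<^sub>R axis a 1) = \<sigma> y + (\<kappa> * s) *\<^sub>R axis a 1" for s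
          unfolding \<sigma>_def \<kappa>_def by (vector axis_def)
        have q_line: "q (y + s *\<^sub>R axis a 1) =
            q y + A a * (2 * (y $ a - x $ a) * s + s\<^sup>2) + B a * s" for s
        proof -
          have "q (y + s *\<^sub>R axis a 1) - q y = (\<Sum>b\<in>UNIV. if b = a then
              A a * (2 * (y $ a - x $ a) * s + s\<^sup>2) + B a * s else 0)"
            unfolding q_def sum_subtractf [symmetric]
            by (rule sum.cong) (auto simp: axis_def power2_eq_square algebra_simps)
          then show ?thesis by simp
        qed
        \<comment> \<open>A step length for which coordinate segments through y stay in K, so that
          the maximum over K is a two-sided maximum along each of them.\<close>
        define d0 where "d0 = Min (insert (y $ j - x $ j) (range (\<lambda>b. d - \<bar>y $ b - x $ b\<bar>)))"
        have d0: "d0 > 0" "d0 \<le> y $ j - x $ j" "\<And>b. d0 \<le> d - \<bar>y $ b - x $ b\<bar>"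
        proof -
          show "d0 > 0"
            unfolding d0_def using strict qy y K [of y] by (subst Min_gr_iff) (auto simp: less_le)
          show "d0 \<le> y $ j - x $ j"
            unfolding d0_def by (rule Min_le) auto
          show "d0 \<le> d - \<bar>y $ b - x $ b\<bar>" for b
            unfolding d0_def by (rule Min_le) auto
        qed
        have inK: "y + s *\<^sub>R axis a 1 \<in> K" if "\<bar>s\<bar> < d0" for s
          unfolding K
        proof (intro conjI allI)
          show "\<bar>(y + s *\<^sub>R axis a 1) $ b - x $ b\<bar> \<le> d" for b
            using d0(3) [of b] that by (auto simp: axis_def)
          show "x $ j \<le> (y + s *\<^sub>R axis a 1) $ j"
            using d0(2) that by (auto simp: axis_def)
        qed
        show ?thesis
        proof (rule second_derivative_local_max [OF d0(1)])
          show "DERIV (\<lambda>s. F (y + s *\<^sub>R axis a 1)) s :>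
             (pd [a] u (y + s *\<^sub>R axis a 1) - \<kappa> * pd [a] u (\<sigma> y + (\<kappa> * s) *\<^sub>R axis a 1)) / 2
               - (A a * (2 * (y $ a - x $ a) + 2 * s) + B a)" for s
            unfolding F_def \<sigma>_line q_line
            by (rule derivative_eq_intros D1 DERIV_chain2 [OF D1] refl | simp)+
          show "DERIV (\<lambda>s. (pd [a] u (y + s *\<^sub>R axis a 1) - \<kappa> * pd [a] u (\<sigma> y + (\<kappa> * s) *\<^sub>R axis a 1)) / 2
               - (A a * (2 * (y $ a - x $ a) + 2 * s) + B a)) 0 :>
             (pd [a, a] u y - pd [a, a] u (\<sigma> y)) / 2 - 2 * A a"
            by (rule derivative_eq_intros D2 DERIV_chain2 [OF D2] refl | simp)+ (simp add: \<kappa>)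
          show "F (y + s *\<^sub>R axis a 1) \<le> F (y + 0 *\<^sub>R axis a 1)" if "\<bar>s\<bar> < d0" for s
            using max [OF inK [OF that]] by simp
        qed
      qed
      then have "(\<Sum>a\<in>UNIV. (pd [a, a] u y - pd [a, a] u (\<sigma> y)) / 2 - 2 * A a) \<le> 0"
        by (intro sum_nonpos) auto
      \<comment> \<open>By the equation the first term is minus the odd part, hence at least -M,
        while the second contributes +2M: the left side cannot be nonpositive.\<close>
      then have "(lap u y - lap u (\<sigma> y)) / 2 - 2 * sum A UNIV \<le> 0"
        by (simp add: lap_def sum_subtractf sum_divide_distrib sum_distrib_left diff_divide_distrib)
      then show False
        using uK [OF y] \<open>M > 0\<close> unfolding sumA lap abs_le_iff by (simp add: field_simps)
    qed
    then show ?thesis using max [OF yK] by simp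
  qed
  \<comment> \<open>F along the ray from x in direction j. It vanishes at 0 and is nonpositive
    afterwards, so its slope at 0, which is \<open>pd [j] u x - B j\<close>, cannot be
    positive.\<close>
  define g where "g = (\<lambda>s. (u (x + s *\<^sub>R axis j 1) - u (x + (- s) *\<^sub>R axis j 1)) / 2 - (A j * s\<^sup>2 + B j * s))"
  have "DERIV g 0 :> (pd [j] u x + pd [j] u x) / 2 - B j"
    unfolding g_def by (rule derivative_eq_intros D1 DERIV_chain2 [OF D1] refl | simp)+
  have g_le: "g s \<le> 0" if "0 < s" "s < d" for s
  proof -
    have "\<sigma> (x + s *\<^sub>R axis j 1) = x + (- s) *\<^sub>R axis j 1"
      unfolding \<sigma>_def by (vector axis_def)
    moreover have "q (x + s *\<^sub>R axis j 1) = (\<Sum>b\<in>UNIV. if b = j then A j * s\<^sup>2 + B j * s else 0)"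
      unfolding q_def by (rule sum.cong) (auto simp: axis_def)
    moreover have "x + s *\<^sub>R axis j 1 \<in> K"
      unfolding K using that by (auto simp: axis_def)
    ultimately show ?thesis
      using F_le [of "x + s *\<^sub>R axis j 1"] by (simp add: F_def g_def)
  qed
  have "pd [j] u x \<le> B j"
  proof (rule ccontr)
    assume "\<not> pd [j] u x \<le> B j"
    then obtain e where "e > 0" and e: "\<And>h. 0 < h \<Longrightarrow> h < e \<Longrightarrow> g 0 < g h"
      using DERIV_pos_inc_right [OF \<open>DERIV g 0 :> _\<close>] by auto
    have "g 0 = 0" by (simp add: g_def)
    moreover have "0 < min d e / 2" "min d e / 2 < e" "min d e / 2 < d"
      using \<open>e > 0\<close> \<open>d > 0\<close> by (auto simp: min_def)
    ultimately show False
      using e [of "min d e / 2"] g_le [of "min d e / 2"] by simp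
  qed
  then show ?thesis by (simp add: B_def)
qed

lemma helmholtz_gradient:
  fixes u :: "real^'n::finite \<Rightarrow> real" and d M :: real
  assumes u: "helmholtz u" and "d > 0" "M > 0"
    and bound: "\<And>y. (\<And>a. \<bar>y $ a - x $ a\<bar> \<le> d) \<Longrightarrow> \<bar>u y\<bar> \<le> M"
  shows "\<bar>pd [j] u x\<bar> \<le> (CARD('n) / d + d) * M"
proof -
  have s: "smooth_on UNIV u" using u by (simp add: helmholtz_def)
  have "helmholtz (\<lambda>x. - u x)"
    using u smooth_on_diff [OF open_UNIV smooth_on_const s, of 0]
    by (auto simp: helmholtz_def lap_def pd_uminus_fun [OF s] sum_negf)
  then have "pd [j] (\<lambda>x. - u x) x \<le> (CARD('n) / d + d) * M"
  proof (rule helmholtz_gradient_upper [OF _ assms(2,3)])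
    fix y assume "\<And>a. \<bar>y $ a - x $ a\<bar> \<le> d"
    then have "\<bar>u y\<bar> \<le> M" by (rule bound)
    then show "\<bar>- u y\<bar> \<le> M" by simp
  qed
  moreover have "pd [j] u x \<le> (CARD('n) / d + d) * M"
    using assms by (rule helmholtz_gradient_upper)
  ultimately show ?thesis
    by (simp add: pd_uminus_fun [OF s])
qed

text \<open>Every inner derivative is again a Helmholtz solution, so each further derivative costs
  one factor and one cube of half-side d; half-sides add up because cubes are balls of the maximum
  norm.\<close>

lemma helmholtz_derivatives:
  fixes u :: "real^'n::finite \<Rightarrow> real" and d M :: real
  assumes u: "helmholtz u" and "d > 0" "M > 0"
    and bound: "\<And>y. (\<And>a. \<bar>y $ a - x $ a\<bar> \<le> length is * d) \<Longrightarrow> \<bar>u y\<bar> \<le> M"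
  shows "\<bar>pd is u x\<bar> \<le> (CARD('n) / d + d) ^ length is * M"
  using bound
proof (induction "is" arbitrary: x)
  case (Cons i "is")
  let ?c = "CARD('n) / d + d"
  have "?c > 0" using \<open>d > 0\<close> by (intro add_nonneg_pos) auto
  have "\<bar>pd [i] (pd is u) x\<bar> \<le> ?c * (?c ^ length is * M)"
  proof (rule helmholtz_gradient)
    fix z assume z: "\<And>a. \<bar>z $ a - x $ a\<bar> \<le> d"
    show "\<bar>pd is u z\<bar> \<le> ?c ^ length is * M"
    proof (rule Cons.IH, rule Cons.prems)
      fix y a assume "\<And>a. \<bar>y $ a - z $ a\<bar> \<le> length is * d"
      then have "\<bar>y $ a - z $ a\<bar> \<le> length is * d" by blast
      with z [of a] show "\<bar>y $ a - x $ a\<bar> \<le> length (i # is) * d"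
        by (simp add: algebra_simps)
    qed
  qed (use \<open>d > 0\<close> \<open>M > 0\<close> \<open>?c > 0\<close> helmholtz_pd [OF u] in auto)
  then show ?case by (simp add: pd_Cons [of i "is"] mult.assoc)
next
  case Nil
  have "\<bar>u x\<bar> \<le> M" by (rule Nil) simp
  then show ?case by simp
qed

section \<open>Taylor expansion of Helmholtz solutions\<close>

text \<open>One term of the exponential series is below its sum. At x = k this is k^k \<le> k! e^k,
  the half of Stirling's formula that turns k-fold iteration into a factorial.\<close>

lemma power_le_fact_exp:
  fixes x :: real
  assumes "x \<ge> 0"
  shows "x ^ k \<le> fact k * exp x"
proof -
  have "(\<lambda>n. x ^ n /\<^sub>R fact n) sums exp x"
    by (rule exp_converges)
  then have "x ^ k /\<^sub>R fact k \<le> exp x"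
    using sum_le_suminf [of "\<lambda>n. x ^ n /\<^sub>R fact n" "{k}"] assms
    by (auto simp: sums_iff)
  then show ?thesis by (simp add: field_simps)
qed

lemma add_power_le:
  fixes a b :: real
  assumes "a \<ge> 0" "b \<ge> 0"
  shows "(a + b) ^ k \<le> 2 ^ k * (a ^ k + b ^ k)"
proof -
  have "(a + b) ^ k \<le> (2 * max a b) ^ k"
    using assms by (intro power_mono) auto
  also have "\<dots> \<le> 2 ^ k * (a ^ k + b ^ k)"
    using assms by (auto simp: power_mult_distrib max_def)
  finally show ?thesis .
qed

text \<open>The total half-side R of the cubes is free: enlarging it only increases M, while the
  geometric rate shrinks like 1/R. Arbitrary \<epsilon> expresses an infinite radius of
  convergence.\<close>

lemma helmholtz_analytic:
  fixes u :: "real^'n::finite \<Rightarrow> real"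
  assumes u: "helmholtz u" and "\<epsilon> > 0"
  shows "\<exists>M\<ge>0. \<forall>is. \<forall>y\<in>cball 0 1. \<bar>pd is u y\<bar> \<le> M * fact (length is) * \<epsilon> ^ length is"
proof -
  let ?n = "real CARD('n)"
  have n: "?n > 0" by simp
  \<comment> \<open>Halving \<epsilon> absorbs the factor 2^k from \<open>add_power_le\<close>. With
    the next choice of R, the term n/d for d = R/k equals k \<eta>/e, whose k-th power is at most k!
    \<eta>^k.\<close>
  define \<eta> where "\<eta> = \<epsilon> / 2"
  define R where "R = ?n * exp 1 / \<eta>"
  have pos: "\<eta> > 0" "R > 0"
    using \<open>\<epsilon> > 0\<close> n by (auto simp: \<eta>_def R_def)
  have "compact (cball (0::real^'n) (1 + ?n * R))" by simp
  moreover have "continuous_on (cball 0 (1 + ?n * R)) u"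
    using u continuous_on_pd [of UNIV u "[]"] continuous_on_subset by (auto simp: helmholtz_def)
  ultimately have "bounded (u ` cball 0 (1 + ?n * R))"
    using compact_continuous_image compact_imp_bounded by blast
  then obtain M where M: "M > 0" "\<And>y. y \<in> cball 0 (1 + ?n * R) \<Longrightarrow> \<bar>u y\<bar> \<le> M"
    unfolding bounded_pos by auto
  have cube: "\<bar>u z\<bar> \<le> M" if "y \<in> cball 0 1" "\<And>a. \<bar>z $ a - y $ a\<bar> \<le> R" for y z
  proof (rule M(2))
    have "norm (z - y) \<le> (\<Sum>a\<in>UNIV. \<bar>(z - y) $ a\<bar>)"
      by (rule norm_le_l1_cart)
    also have "\<dots> \<le> ?n * R"
      using that(2) sum_bounded_above [of UNIV "\<lambda>a. \<bar>(z - y) $ a\<bar>" R] by simp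
    finally have "norm z \<le> norm y + ?n * R"
      using norm_triangle_sub [of z y] by simp
    then show "z \<in> cball 0 (1 + ?n * R)" using that(1) by simp
  qed
  have main: "(?n / (R / k) + R / k) ^ k \<le> (1 + exp (R / \<eta>)) * fact k * \<epsilon> ^ k" if "k > 0" for k
  proof -
    have 1: "(?n / (R / k)) ^ k \<le> fact k * \<eta> ^ k"
    proof -
      have "(?n / (R / k)) ^ k = real k ^ k * (\<eta> / exp 1) ^ k"
      proof -
        have "?n / (R / k) = real k * (\<eta> / exp 1)"
          using pos n by (simp add: R_def)
        then show ?thesis by (simp only: power_mult_distrib)
      qed
      also have "\<dots> \<le> fact k * exp k * (\<eta> / exp 1) ^ k"
        using pos by (intro mult_right_mono power_le_fact_exp) auto
      also have "\<dots> = fact k * \<eta> ^ k"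
        by (simp add: power_divide exp_of_nat_mult [symmetric])
      finally show ?thesis .
    qed
    have 2: "(R / k) ^ k \<le> exp (R / \<eta>) * fact k * \<eta> ^ k"
    proof -
      have "(R / k) ^ k \<le> R ^ k"
        using pos that by (intro power_mono) (auto simp: field_simps)
      also have "\<dots> = (R / \<eta>) ^ k * \<eta> ^ k"
        using pos by (simp flip: power_mult_distrib)
      also have "\<dots> \<le> fact k * exp (R / \<eta>) * \<eta> ^ k"
        using pos by (intro mult_right_mono power_le_fact_exp) auto
      finally show ?thesis by (simp add: mult_ac)
    qed
    have "(?n / (R / k) + R / k) ^ k \<le> 2 ^ k * ((?n / (R / k)) ^ k + (R / k) ^ k)"
      using pos by (intro add_power_le) auto
    also have "\<dots> \<le> 2 ^ k * (fact k * \<eta> ^ k + exp (R / \<eta>) * fact k * \<eta> ^ k)"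
      by (intro mult_left_mono add_mono 1 2) simp
    also have "\<dots> = (1 + exp (R / \<eta>)) * fact k * (2 * \<eta>) ^ k"
      unfolding power_mult_distrib by (simp add: ring_distribs mult.assoc mult.left_commute [of "2 ^ k"])
    finally show ?thesis by (simp add: \<eta>_def)
  qed
  have "\<bar>pd is u y\<bar> \<le> M * (1 + exp (R / \<eta>)) * fact (length is) * \<epsilon> ^ length is" if y: "y \<in> cball 0 1" for "is" y
  proof (cases "is = []")
    \<comment> \<open>Order 0 is treated apart, since a cube of half-side R / k makes no sense
      there.\<close>
    case True
    have "\<bar>u y\<bar> \<le> M * 1"
      using cube [OF y, of y] pos by simp
    also have "\<dots> \<le> M * (1 + exp (R / \<eta>))"
      using M(1) by (intro mult_left_mono) auto
    finally show ?thesis using True by simp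
  next
    case False
    let ?k = "length is"
    have k: "?k > 0" using False by simp
    have "\<bar>pd is u y\<bar> \<le> (?n / (R / ?k) + R / ?k) ^ ?k * M"
    proof (rule helmholtz_derivatives [OF u _ M(1)])
      show "R / ?k > 0" using pos k by simp
      fix z assume z: "\<And>a. \<bar>z $ a - y $ a\<bar> \<le> ?k * (R / ?k)"
      have "\<bar>z $ a - y $ a\<bar> \<le> R" for a
        using z [of a] False by simp
      then show "\<bar>u z\<bar> \<le> M" by (rule cube [OF y])
    qed
    also have "\<dots> \<le> (1 + exp (R / \<eta>)) * fact ?k * \<epsilon> ^ ?k * M"
      using main [OF k] M(1) by (intro mult_right_mono) auto
    finally show ?thesis by (simp add: mult_ac)
  qed
  then show ?thesis
    using M(1) by (intro exI [of _ "M * (1 + exp (R / \<eta>))"]) (simp add: add_nonneg_nonneg)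
qed

text \<open>The $k$-th total derivative of $f$ at $y$, evaluated on $k$ copies of $x$.\<close>

primrec taylor_form :: "nat \<Rightarrow> (real^'n::finite \<Rightarrow> real) \<Rightarrow> real^'n \<Rightarrow> real^'n \<Rightarrow> real" where
  "taylor_form 0 f y x = f y"
| "taylor_form (Suc k) f y x = (\<Sum>i\<in>UNIV. x $ i * taylor_form k (pd [i] f) y x)"

lemma taylor_form_le:
  assumes "\<And>is. length is = k \<Longrightarrow> \<bar>pd is f y\<bar> \<le> B"
  shows "\<bar>taylor_form k f y x\<bar> \<le> (\<Sum>i\<in>UNIV. \<bar>x $ i\<bar>) ^ k * B"
  using assms
proof (induction k arbitrary: f)
  case 0
  have "\<bar>pd [] f y\<bar> \<le> B" by (rule 0) simp
  then show ?case by simp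
next
  case (Suc k)
  let ?s = "\<Sum>i\<in>UNIV. \<bar>x $ i\<bar>"
  have "\<bar>pd is (pd [i] f) y\<bar> \<le> B" if "length is = k" for i "is"
    using Suc.prems [of "is @ [i]"] that by (simp add: pd_append)
  then have IH: "\<bar>taylor_form k (pd [i] f) y x\<bar> \<le> ?s ^ k * B" for i
    by (intro Suc.IH)
  have "\<bar>taylor_form (Suc k) f y x\<bar> \<le> (\<Sum>i\<in>UNIV. \<bar>x $ i * taylor_form k (pd [i] f) y x\<bar>)"
    by (simp add: sum_abs)
  also have "\<dots> \<le> (\<Sum>i\<in>UNIV. \<bar>x $ i\<bar> * (?s ^ k * B))"
    using IH by (intro sum_mono) (simp add: abs_mult mult_left_mono)
  also have "\<dots> = ?s ^ Suc k * B"
    unfolding sum_distrib_right [symmetric] by simp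
  finally show ?case .
qed

lemma taylor_form_scaleR: "taylor_form k f y (c *\<^sub>R x) = c ^ k * taylor_form k f y x"
  by (induction k arbitrary: f) (simp_all add: sum_distrib_left mult_ac)

text \<open>With the direction x frozen, moving the base point along the ray raises the order by
  one. These are the successive derivatives that the one-variable Maclaurin formula asks
  for.\<close>

lemma has_real_derivative_taylor_form:
  assumes "smooth_on UNIV f"
  shows "DERIV (\<lambda>s. taylor_form k f (s *\<^sub>R x) x) s :> taylor_form (Suc k) f (s *\<^sub>R x) x"
  using assms
proof (induction k arbitrary: f)
  case 0
  then show ?case
    using has_real_derivative_line [of f 0 s x] smooth_on_imp_differentiable [OF 0] by simp
next
  case (Suc k)
  have "DERIV (\<lambda>s. taylor_form k (pd [i] f) (s *\<^sub>R x) x) s :> taylor_form (Suc k) (pd [i] f) (s *\<^sub>R x) x" for i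
    by (rule Suc.IH) (rule smooth_on_pd [OF Suc.prems])
  then have "DERIV (\<lambda>s. \<Sum>i\<in>UNIV. x $ i * taylor_form k (pd [i] f) (s *\<^sub>R x) x) s :>
      (\<Sum>i\<in>UNIV. x $ i * taylor_form (Suc k) (pd [i] f) (s *\<^sub>R x) x)"
    by (intro DERIV_sum DERIV_cmult)
  then show ?case by simp
qed

definition taylor_rem :: "nat \<Rightarrow> (real^'n::finite \<Rightarrow> real) \<Rightarrow> real^'n \<Rightarrow> real" where
  "taylor_rem N f x = f x - (\<Sum>k<N. taylor_form k f 0 x / fact k)"

lemma taylor_rem_le:
  fixes f :: "real^'n::finite \<Rightarrow> real" and B :: real
  assumes "smooth_on UNIV f"
    and B: "\<And>is y. length is = N \<Longrightarrow> y \<in> cball 0 1 \<Longrightarrow> \<bar>pd is f y\<bar> \<le> B"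
    and x: "x \<in> cball 0 1"
  shows "\<bar>taylor_rem N f x\<bar> \<le> CARD('n) ^ N * B / fact N"
proof -
  have "\<exists>t. \<bar>t\<bar> \<le> \<bar>1\<bar> \<and> f (1 *\<^sub>R x) = (\<Sum>m<N. (taylor_form m f (0 *\<^sub>R x) x / fact m) * 1 ^ m)
      + (taylor_form N f (t *\<^sub>R x) x / fact N) * 1 ^ N"
    using Maclaurin_all_le [of "\<lambda>m s. taylor_form m f (s *\<^sub>R x) x" "\<lambda>s. f (s *\<^sub>R x)" 1 N]
      has_real_derivative_taylor_form [OF assms(1)] by fastforce
  then obtain t where t: "\<bar>t\<bar> \<le> 1" "taylor_rem N f x = taylor_form N f (t *\<^sub>R x) x / fact N"
    by (auto simp: taylor_rem_def)
  have "norm (t *\<^sub>R x) \<le> 1 * 1"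
    unfolding norm_scaleR using t x by (intro mult_mono) auto
  then have "\<bar>taylor_form N f (t *\<^sub>R x) x\<bar> \<le> (\<Sum>i\<in>UNIV. \<bar>x $ i\<bar>) ^ N * B"
    using B by (intro taylor_form_le) auto
  also have "\<dots> \<le> CARD('n) ^ N * B"
  proof (rule mult_right_mono)
    have "\<bar>x $ i\<bar> \<le> 1" for i
      using component_le_norm_cart [of x i] x by simp
    then show "(\<Sum>i\<in>UNIV. \<bar>x $ i\<bar>) ^ N \<le> CARD('n) ^ N"
      using sum_bounded_above [of UNIV "\<lambda>i. \<bar>x $ i\<bar>" 1]
      by (simp add: power_mono sum_nonneg)
    \<comment> \<open>The hypothesis bounds an absolute value by B, so any word of length N,
      evaluated at the origin, is a witness.\<close>
    show "B \<ge> 0"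
      using B [of "replicate N undefined" 0] by fastforce
  qed
  finally show ?thesis
    by (simp add: t(2) divide_right_mono)
qed

lemma smooth_on_coord: "smooth_on S (\<lambda>x. x $ i)"
  by (rule smooth_on_linear) (rule bounded_linear_vec_nth)

lemma pd_coord: "pd [i] (\<lambda>x. x $ j) = (\<lambda>x. if i = j then 1 else 0)"
  by (subst pd_linear [OF bounded_linear_vec_nth]) (auto simp: axis_def)

lemma smooth_on_taylor_form: "smooth_on UNIV (taylor_form k f y)"
proof (induction k arbitrary: f)
  case 0
  have "taylor_form 0 f y = (\<lambda>x. f y)" by auto
  then show ?case by (simp only: smooth_on_const)
next
  case (Suc k)
  have "taylor_form (Suc k) f y = (\<lambda>x. \<Sum>i\<in>UNIV. x $ i * taylor_form k (pd [i] f) y x)"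
    by auto
  then show ?case
    using Suc by (auto intro!: smooth_on_sum smooth_on_mult smooth_on_coord)
qed

text \<open>The form is a symmetric multilinear map on equal arguments. The product rule yields one
  copy from the outermost slot and, by induction, k + 1 copies from the inner ones;
  \<open>pd_commute\<close> makes all of them equal.\<close>

lemma pd_taylor_form:
  assumes "smooth_on UNIV f"
  shows "pd [i] (taylor_form (Suc k) f y) x = Suc k * taylor_form k (pd [i] f) y x"
  using assms
proof (induction k arbitrary: f)
  case 0
  have "taylor_form (Suc 0) f y = (\<lambda>x. \<Sum>j\<in>UNIV. pd [j] f y *\<^sub>R x $ j)"
    by (auto simp: mult.commute)
  moreover have "pd [i] \<dots> x = (\<Sum>j\<in>UNIV. pd [j] f y *\<^sub>R pd [i] (\<lambda>x. x $ j) x)"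
    by (subst pd_list_sum [OF open_UNIV])
       (auto intro!: sum.cong smooth_on_coord pd_list_compose_linear [OF bounded_linear_scaleR_right open_UNIV]
          smooth_on_compose_linear [OF bounded_linear_scaleR_right] simp del: real_scaleR_def)
  ultimately show ?case
    by (simp add: pd_coord if_distrib [of "\<lambda>x. _ * x"] cong: if_cong)
next
  case (Suc k)
  let ?T = "\<lambda>j. taylor_form (Suc k) (pd [j] f) y"
  have sm: "smooth_on UNIV (\<lambda>x. x $ j * ?T j x)" for j
    by (intro smooth_on_mult smooth_on_coord smooth_on_taylor_form) auto
  have "taylor_form (Suc (Suc k)) f y = (\<lambda>x. \<Sum>j\<in>UNIV. x $ j * ?T j x)"
    by (rule ext) (simp only: taylor_form.simps)
  then have "pd [i] (taylor_form (Suc (Suc k)) f y) x = (\<Sum>j\<in>UNIV. pd [i] (\<lambda>x. x $ j * ?T j x) x)"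
    by (simp only: pd_list_sum [OF open_UNIV sm UNIV_I])
  also have "\<dots> = (\<Sum>j\<in>UNIV. (if i = j then 1 else 0) * ?T j x + x $ j * (Suc k * taylor_form k (pd [i] (pd [j] f)) y x))"
  proof (rule sum.cong [OF refl])
    fix j
    show "pd [i] (\<lambda>x. x $ j * ?T j x) x =
        (if i = j then 1 else 0) * ?T j x + x $ j * (Suc k * taylor_form k (pd [i] (pd [j] f)) y x)"
      using Suc.IH [OF smooth_on_pd [OF Suc.prems], of "[j]"]
        smooth_on_imp_differentiable [OF smooth_on_taylor_form UNIV_I] smooth_on_imp_differentiable [OF smooth_on_coord UNIV_I]
      by (subst pd_mult) (simp_all add: pd_coord del: taylor_form.simps)
  qed
  also have "\<dots> = (\<Sum>j\<in>UNIV. if i = j then ?T j x else 0) + Suc k * ?T i x"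
    unfolding pd_commute [OF Suc.prems, of i] sum.distrib taylor_form.simps sum_distrib_left
    by (intro arg_cong2 [where f = "(+)"] sum.cong) (simp_all add: mult.left_commute)
  also have "\<dots> = Suc (Suc k) * ?T i x"
    by (simp add: algebra_simps del: taylor_form.simps)
  finally show ?case .
qed

lemma taylor_form_laplacian:
  assumes "helmholtz f"
  shows "(\<Sum>i\<in>UNIV. taylor_form k (pd [i] (pd [i] f)) y x) = - taylor_form k f y x"
  using assms
proof (induction k arbitrary: f)
  case 0
  then show ?case by (simp add: helmholtz_def lap_def pd_Cons [of _ "[_]"])
next
  case (Suc k)
  have f: "smooth_on UNIV f" using Suc.prems by (simp add: helmholtz_def)
  have comm: "pd [j] (pd [i] (pd [i] f)) = pd [i] (pd [i] (pd [j] f))" for i j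
    using pd_commute [OF f, of j i] pd_commute [OF smooth_on_pd [OF f], of j i "[i]"] by simp
  have "(\<Sum>i\<in>UNIV. taylor_form (Suc k) (pd [i] (pd [i] f)) y x)
      = (\<Sum>j\<in>UNIV. x $ j * (\<Sum>i\<in>UNIV. taylor_form k (pd [i] (pd [i] (pd [j] f))) y x))"
    unfolding taylor_form.simps comm sum_distrib_left by (rule sum.swap)
  also have "\<dots> = - taylor_form (Suc k) f y x"
    using Suc.IH [OF helmholtz_pd_single [OF Suc.prems]] by (simp add: sum_negf)
  finally show ?case .
qed

section \<open>A submultiplicative $C^r$ norm\<close>

text \<open>The recursion $|f|_{r+1} = |f|_r + \sum_i |\partial_i f|_r$ makes submultiplicativity a direct
  consequence of the product rule.\<close>

primrec Cr_le :: "(real^'n::finite) set \<Rightarrow> nat \<Rightarrow> (real^'n \<Rightarrow> real) \<Rightarrow> real \<Rightarrow> bool" where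
  "Cr_le S 0 f K \<longleftrightarrow> 0 \<le> K \<and> (\<forall>x\<in>S. \<bar>f x\<bar> \<le> K)"
| "Cr_le S (Suc r) f K \<longleftrightarrow> (\<forall>x\<in>S. f differentiable (at x)) \<and>
     (\<exists>K0 D. Cr_le S r f K0 \<and> (\<forall>i. Cr_le S r (pd [i] f) (D i)) \<and> K0 + sum D UNIV \<le> K)"

lemma Cr_leI:
  assumes "\<And>x. x \<in> S \<Longrightarrow> f differentiable (at x)" "Cr_le S r f K0"
    "\<And>i. Cr_le S r (pd [i] f) (D i)" "K0 + sum D UNIV \<le> K"
  shows "Cr_le S (Suc r) f K"
  unfolding Cr_le.simps using assms by blast

lemma Cr_leE:
  assumes "Cr_le S (Suc r) f K"
  obtains K0 D where "\<And>x. x \<in> S \<Longrightarrow> f differentiable (at x)" "Cr_le S r f K0"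
    "\<And>i. Cr_le S r (pd [i] f) (D i)" "K0 + sum D UNIV \<le> K"
  using assms unfolding Cr_le.simps by blast

lemma Cr_le_nonneg: "Cr_le S r f K \<Longrightarrow> 0 \<le> K"
proof (induction r arbitrary: f K)
  case (Suc r)
  obtain K0 D where "Cr_le S r f K0" "\<And>i. Cr_le S r (pd [i] f) (D i)" "K0 + sum D UNIV \<le> K"
    using Suc.prems by (rule Cr_leE) blast
  then have "0 \<le> K0" "\<And>i. 0 \<le> D i" "K0 + sum D UNIV \<le> K"
    using Suc.IH by blast+
  then show ?case
    using sum_nonneg [of UNIV D] by simp
qed simp

lemma Cr_le_mono:
  assumes "Cr_le S r f K" "K \<le> K'"
  shows "Cr_le S r f K'"
proof (cases r)
  case 0
  then show ?thesis using assms by fastforce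
next
  case (Suc q)
  then show ?thesis
    using assms(1) order_trans [OF _ assms(2)] by (auto elim!: Cr_leE intro: Cr_leI simp del: Cr_le.simps)
qed

lemma Cr_le_SucD:
  assumes "Cr_le S (Suc r) f K"
  shows "Cr_le S r f K"
proof -
  obtain K0 D where "Cr_le S r f K0" and D: "\<And>i. Cr_le S r (pd [i] f) (D i)" and le: "K0 + sum D UNIV \<le> K"
    using assms by (rule Cr_leE) blast
  moreover have "0 \<le> sum D UNIV"
    using D Cr_le_nonneg by (intro sum_nonneg) blast
  ultimately show ?thesis
    by (intro Cr_le_mono [of S r f K0 K]) linarith+
qed

lemma Cr_le_imp_abs_le: "Cr_le S r f K \<Longrightarrow> x \<in> S \<Longrightarrow> \<bar>f x\<bar> \<le> K"
proof (induction r)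
  case (Suc r)
  show ?case by (rule Suc.IH [OF Cr_le_SucD [OF Suc.prems(1)] Suc.prems(2)])
qed simp

text \<open>The way back to the supremum norm: each partial derivative of order at most r is one of
  the nonnegative quantities that the recursive norm adds up.\<close>

lemma Cr_le_pd:
  assumes "Cr_le S r f K" "length is \<le> r" "x \<in> S"
  shows "\<bar>pd is f x\<bar> \<le> K"
  using assms(1,2)
proof (induction "is" arbitrary: r f K rule: rev_induct)
  case Nil
  then show ?case using Cr_le_imp_abs_le assms(3) by simp
next
  case (snoc i "is")
  then obtain q where r: "r = Suc q" by (cases r) auto
  obtain K0 D where K0: "Cr_le S q f K0" and D: "\<And>i. Cr_le S q (pd [i] f) (D i)" and le: "K0 + sum D UNIV \<le> K"
    using snoc.prems(1) unfolding r by (rule Cr_leE) blast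
  have "\<bar>pd is (pd [i] f) x\<bar> \<le> D i"
    using snoc.prems(2) r by (intro snoc.IH [OF D]) simp
  also have "\<dots> \<le> sum D UNIV"
    by (intro member_le_sum Cr_le_nonneg [OF D]) auto
  also have "\<dots> \<le> K"
    using le Cr_le_nonneg [OF K0] by simp
  finally show ?case by (simp add: pd_append)
qed

context
  fixes S :: "(real^'n::finite) set"
  assumes S: "open S"
begin

lemma Cr_le_cong:
  assumes "\<And>y. y \<in> S \<Longrightarrow> f y = g y" "Cr_le S r f K"
  shows "Cr_le S r g K"
  using assms
proof (induction r arbitrary: f g K)
  case (Suc r)
  obtain K0 D where df: "\<And>x. x \<in> S \<Longrightarrow> f differentiable (at x)" and K0: "Cr_le S r f K0"
    and D: "\<And>i. Cr_le S r (pd [i] f) (D i)" and le: "K0 + sum D UNIV \<le> K"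
    using Suc.prems(2) by (rule Cr_leE) blast
  show ?case
  proof (rule Cr_leI [OF _ _ _ le])
    show "g differentiable (at x)" if "x \<in> S" for x
      using differentiable_cong_open [OF S that Suc.prems(1) df [OF that]] .
    show "Cr_le S r g K0"
      using Suc.prems(1) K0 by (rule Suc.IH)
    show "Cr_le S r (pd [i] g) (D i)" for i
      by (rule Suc.IH [OF _ D]) (rule pd_cong [OF S Suc.prems(1)])
  qed
qed auto

lemma Cr_le_add:
  assumes "Cr_le S r f K" "Cr_le S r g L"
  shows "Cr_le S r (\<lambda>x. f x + g x) (K + L)"
  using assms
proof (induction r arbitrary: f g K L)
  case 0
  then show ?case by (auto intro: abs_triangle_ineq [THEN order_trans] add_mono)
next
  case (Suc r)
  obtain K0 D where df: "\<And>x. x \<in> S \<Longrightarrow> f differentiable (at x)" and K0: "Cr_le S r f K0"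
    and D: "\<And>i. Cr_le S r (pd [i] f) (D i)" and K: "K0 + sum D UNIV \<le> K"
    using Suc.prems(1) by (rule Cr_leE) blast
  obtain L0 E where dg: "\<And>x. x \<in> S \<Longrightarrow> g differentiable (at x)" and L0: "Cr_le S r g L0"
    and E: "\<And>i. Cr_le S r (pd [i] g) (E i)" and L: "L0 + sum E UNIV \<le> L"
    using Suc.prems(2) by (rule Cr_leE) blast
  show ?case
  proof (rule Cr_leI)
    show "(\<lambda>x. f x + g x) differentiable (at x)" if "x \<in> S" for x
      using df dg that by (intro differentiable_add) auto
    show "Cr_le S r (\<lambda>x. f x + g x) (K0 + L0)"
      using K0 L0 by (rule Suc.IH)
    show "Cr_le S r (pd [i] (\<lambda>x. f x + g x)) (D i + E i)" for i
      by (rule Cr_le_cong [OF pd_add [OF df dg, symmetric] Suc.IH [OF D E]])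
    show "K0 + L0 + (\<Sum>i\<in>UNIV. D i + E i) \<le> K + L"
      using K L by (simp add: sum.distrib)
  qed
qed

lemma Cr_le_mult:
  assumes "Cr_le S r f K" "Cr_le S r g L"
  shows "Cr_le S r (\<lambda>x. f x * g x) (K * L)"
  using assms
proof (induction r arbitrary: f g K L)
  case 0
  then show ?case by (simp add: abs_mult mult_mono)
next
  case (Suc r)
  obtain K0 D where df: "\<And>x. x \<in> S \<Longrightarrow> f differentiable (at x)" and K0: "Cr_le S r f K0"
    and D: "\<And>i. Cr_le S r (pd [i] f) (D i)" and K: "K0 + sum D UNIV \<le> K"
    using Suc.prems(1) by (rule Cr_leE) blast
  obtain L0 E where dg: "\<And>x. x \<in> S \<Longrightarrow> g differentiable (at x)" and L0: "Cr_le S r g L0"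
    and E: "\<And>i. Cr_le S r (pd [i] g) (E i)" and L: "L0 + sum E UNIV \<le> L"
    using Suc.prems(2) by (rule Cr_leE) blast
  note nonneg = Cr_le_nonneg [OF K0] Cr_le_nonneg [OF L0] Cr_le_nonneg [OF D] Cr_le_nonneg [OF E]
  show ?case
  proof (rule Cr_leI)
    show "(\<lambda>x. f x * g x) differentiable (at x)" if "x \<in> S" for x
      using df dg that by (intro differentiable_mult) auto
    show "Cr_le S r (\<lambda>x. f x * g x) (K0 * L0)"
      using K0 L0 by (rule Suc.IH)
    show "Cr_le S r (pd [i] (\<lambda>x. f x * g x)) (D i * L0 + K0 * E i)" for i
      by (rule Cr_le_cong [OF pd_mult [OF df dg, symmetric] Cr_le_add [OF Suc.IH [OF D L0] Suc.IH [OF K0 E]]])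
    \<comment> \<open>Expanding the product of the two norms gives exactly the terms of the product
      rule and this surplus.\<close>
    have "0 \<le> sum D UNIV * sum E UNIV"
      using nonneg by (intro mult_nonneg_nonneg sum_nonneg)
    then have "K0 * L0 + (\<Sum>i\<in>UNIV. D i * L0 + K0 * E i) \<le> (K0 + sum D UNIV) * (L0 + sum E UNIV)"
      unfolding sum.distrib sum_distrib_left [symmetric] sum_distrib_right [symmetric] ring_distribs by linarith
    also have "\<dots> \<le> K * L"
      using K L nonneg Cr_le_nonneg [OF Suc.prems(1)] by (intro mult_mono add_nonneg_nonneg sum_nonneg) auto
    finally show "K0 * L0 + (\<Sum>i\<in>UNIV. D i * L0 + K0 * E i) \<le> K * L" .
  qed
qed

lemma Cr_le_const: "\<bar>c\<bar> \<le> K \<Longrightarrow> Cr_le S r (\<lambda>x. c) K"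
proof (induction r arbitrary: c K)
  case (Suc r)
  have "Cr_le S r (\<lambda>x. c) K" "Cr_le S r (\<lambda>x. 0) 0"
    using Suc by auto
  then show ?case
    by (intro Cr_leI [of _ _ _ K "\<lambda>i. 0"]) auto
qed auto

lemma Cr_le_cmult: "Cr_le S r f K \<Longrightarrow> Cr_le S r (\<lambda>x. c * f x) (\<bar>c\<bar> * K)"
  by (intro Cr_le_mult Cr_le_const) auto

lemma Cr_le_diff:
  assumes "Cr_le S r f K" "Cr_le S r g L"
  shows "Cr_le S r (\<lambda>x. f x - g x) (K + L)"
  using Cr_le_add [OF assms(1) Cr_le_cmult [OF assms(2), of "-1"]] by simp

lemma Cr_le_sum:
  assumes "\<And>a. a \<in> A \<Longrightarrow> Cr_le S r (f a) (K a)"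
  shows "Cr_le S r (\<lambda>x. \<Sum>a\<in>A. f a x) (\<Sum>a\<in>A. K a)"
  using assms
proof (induction A rule: infinite_finite_induct)
  case (insert a A)
  then show ?case by (simp add: Cr_le_add)
qed (simp_all add: Cr_le_const)

text \<open>\<open>f * g - 1 = (f - 1) * (g - 1) + (f - 1) + (g - 1)\<close>, and K, L satisfy the
  same identity. Closeness to 1, recorded as K - 1, therefore multiplies like K itself, which keeps
  high powers of factors near 1 under control.\<close>

lemma Cr_le_mult_minus_one:
  assumes "Cr_le S r (\<lambda>x. f x - 1) (K - 1)" "Cr_le S r (\<lambda>x. g x - 1) (L - 1)"
  shows "Cr_le S r (\<lambda>x. f x * g x - 1) (K * L - 1)"
proof -
  have "Cr_le S r (\<lambda>x. (f x - 1) * (g x - 1) + (f x - 1) + (g x - 1)) ((K - 1) * (L - 1) + (K - 1) + (L - 1))"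
    by (intro Cr_le_add Cr_le_mult assms)
  then show ?thesis by (simp add: algebra_simps)
qed

lemma Cr_le_power_minus_one:
  assumes "Cr_le S r (\<lambda>x. f x - 1) (K - 1)"
  shows "Cr_le S r (\<lambda>x. f x ^ m - 1) (K ^ m - 1)"
proof (induction m)
  case (Suc m)
  then show ?case using Cr_le_mult_minus_one [OF assms Suc] by simp
qed (simp add: Cr_le_const)

end

lemma Cr_le_coord: "\<exists>K\<ge>0. \<forall>i. Cr_le (ball 0 1) r (\<lambda>x::real^'n::finite. x $ i) K"
proof (induction r)
  case 0
  have "\<bar>x $ i\<bar> \<le> 1" if "x \<in> ball 0 1" for x :: "real^'n" and i
    using component_le_norm_cart [of x i] that by simp
  then show ?case by (intro exI [of _ 1]) simp
next
  case (Suc r)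
  then obtain K where K: "K \<ge> 0" "\<And>i. Cr_le (ball 0 1) r (\<lambda>x::real^'n. x $ i) K" by blast
  have "Cr_le (ball 0 1) (Suc r) (\<lambda>x::real^'n. x $ i) (K + (\<Sum>j\<in>(UNIV::'n set). 1))" for i
    using smooth_on_imp_differentiable [OF smooth_on_coord UNIV_I] K(2)
    by (intro Cr_leI [of _ _ _ K "\<lambda>_. 1"]) (auto simp: pd_coord intro!: Cr_le_const)
  moreover have "0 \<le> K + (\<Sum>j\<in>(UNIV::'n set). 1)"
    using K(1) by simp
  ultimately show ?case by blast
qed

text \<open>The constant term drops out and the factor k + 1 reduces (k + 1)! to k!. Bounds in C^r
  for remainders thus reduce to uniform bounds for remainders of derivatives, which are Helmholtz
  solutions too.\<close>

lemma pd_taylor_rem: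
  fixes f :: "real^'n::finite \<Rightarrow> real"
  assumes f: "smooth_on UNIV f"
  shows "pd [i] (taylor_rem (Suc N) f) = taylor_rem N (pd [i] f)"
proof
  fix x
  have sm: "smooth_on UNIV (\<lambda>x. (- 1 / fact k) *\<^sub>R taylor_form k f 0 x)" for k :: nat
    by (intro smooth_on_compose_linear [OF bounded_linear_scaleR_right] smooth_on_taylor_form open_UNIV)
  have t: "pd [i] (\<lambda>x. (- 1 / fact k) *\<^sub>R taylor_form k f 0 x) x = (- 1 / fact k) *\<^sub>R pd [i] (taylor_form k f 0) x" for k
    by (rule pd_list_compose_linear [OF bounded_linear_scaleR_right open_UNIV smooth_on_taylor_form UNIV_I])
  have "taylor_rem (Suc N) f = (\<lambda>x. f x + (\<Sum>k<Suc N. (- 1 / fact k) *\<^sub>R taylor_form k f 0 x))"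
    by (auto simp: taylor_rem_def sum_negf)
  then have "pd [i] (taylor_rem (Suc N) f) x = pd [i] f x + (\<Sum>k<Suc N. (- 1 / fact k) *\<^sub>R pd [i] (taylor_form k f 0) x)"
    using f sm by (simp only: pd_list_add [OF open_UNIV f smooth_on_sum [OF open_UNIV sm] UNIV_I] pd_list_sum [OF open_UNIV sm UNIV_I] t)
  also have "(\<Sum>k<Suc N. (- 1 / fact k) *\<^sub>R pd [i] (taylor_form k f 0) x)
      = (\<Sum>k<N. - (taylor_form k (pd [i] f) 0 x / fact k))"
  proof -
    have "taylor_form 0 f 0 = (\<lambda>x. f 0)" by auto
    then show ?thesis
      unfolding sum.lessThan_Suc_shift pd_taylor_form [OF f] by (simp add: field_simps del: of_nat_Suc)
  qed
  finally show "pd [i] (taylor_rem (Suc N) f) x = taylor_rem N (pd [i] f) x"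
    unfolding taylor_rem_def [of N] by (simp only: sum_negf diff_conv_add_uminus)
qed

lemma smooth_on_taylor_rem:
  assumes "smooth_on UNIV f"
  shows "smooth_on UNIV (taylor_rem N f)"
proof -
  have "smooth_on UNIV (\<lambda>x. f x - (\<Sum>k<N. (1 / fact k) *\<^sub>R taylor_form k f 0 x))"
    by (intro smooth_on_diff smooth_on_sum smooth_on_compose_linear [OF bounded_linear_scaleR_right]
        smooth_on_taylor_form open_UNIV assms)
  then show ?thesis by (simp add: taylor_rem_def [abs_def])
qed

text \<open>The base 4 leaves room for the factor $k^2$ that appears in the error of the individual terms.\<close>

lemma Cr_le_taylor_rem:
  fixes u :: "real^'n::finite \<Rightarrow> real"
  assumes "helmholtz u"
  shows "\<exists>K. \<forall>N. Cr_le (ball 0 1) r (taylor_rem N u) (K / 4 ^ N)"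
  using assms
proof (induction r arbitrary: u)
  case 0
  let ?n = "real CARD('n)"
  \<comment> \<open>The factor 1/n cancels the n^N that \<open>taylor_rem_le\<close> loses in
    comparing the l1 norm with the Euclidean one; 4^-N remains.\<close>
  have "1 / (4 * ?n) > 0" by simp
  from helmholtz_analytic [OF 0 this] obtain M where M: "M \<ge> 0"
    "\<And>is y. y \<in> cball 0 1 \<Longrightarrow> \<bar>pd is u y\<bar> \<le> M * fact (length is) * (1 / (4 * ?n)) ^ length is"
    by blast
  have "\<bar>taylor_rem N u x\<bar> \<le> M / 4 ^ N" if "x \<in> ball 0 1" for N x
  proof -
    have "\<bar>taylor_rem N u x\<bar> \<le> ?n ^ N * (M * fact N * (1 / (4 * ?n)) ^ N) / fact N"
      using taylor_rem_le [of u N "M * fact N * (1 / (4 * ?n)) ^ N" x] M(2) 0 that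
      by (auto simp: helmholtz_def)
    also have "\<dots> = M / 4 ^ N"
      by (simp add: power_mult_distrib power_divide)
    finally show ?thesis .
  qed
  then show ?case using M(1) by (intro exI [of _ M]) simp
next
  case (Suc r)
  have u: "smooth_on UNIV u" using Suc.prems by (simp add: helmholtz_def)
  obtain K where K: "\<And>N. Cr_le (ball 0 1) r (taylor_rem N u) (K / 4 ^ N)"
    using Suc by blast
  have "\<exists>D. \<forall>i N. Cr_le (ball 0 1) r (taylor_rem N (pd [i] u)) (D i / 4 ^ N)"
    using Suc.IH [OF helmholtz_pd_single [OF Suc.prems]] by metis
  then obtain D where D: "\<And>i N. Cr_le (ball 0 1) r (taylor_rem N (pd [i] u)) (D i / 4 ^ N)"
    by blast
  \<comment> \<open>A derivative lowers the order of the remainder by one, which costs one factor 4.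
    At N = 0 the remainder is u itself, nothing is lowered, and the factor 4 is merely
    generous.\<close>
  have "Cr_le (ball 0 1) (Suc r) (taylor_rem N u) ((K + 4 * sum D UNIV) / 4 ^ N)" for N
  proof (rule Cr_leI [OF _ K])
    show "taylor_rem N u differentiable (at x)" for x
      using smooth_on_imp_differentiable [OF smooth_on_taylor_rem [OF u]] by blast
    show "Cr_le (ball 0 1) r (pd [i] (taylor_rem N u)) (4 * D i / 4 ^ N)" for i
    proof (cases N)
      case 0
      have "taylor_rem 0 f = f" for f :: "real^'n \<Rightarrow> real"
        by (auto simp: taylor_rem_def)
      then show ?thesis
        using D [of 0 i] Cr_le_nonneg [OF D [of 0 i]] 0 by (auto intro: Cr_le_mono)
    next
      case (Suc M)
      then show ?thesis using D [of M i] by (simp add: pd_taylor_rem [OF u])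
    qed
    show "K / 4 ^ N + (\<Sum>i\<in>UNIV. 4 * D i / 4 ^ N) \<le> (K + 4 * sum D UNIV) / 4 ^ N"
      by (simp add: add_divide_distrib sum_divide_distrib [symmetric] sum_distrib_left)
  qed
  then show ?case by blast
qed

text \<open>A Taylor term is the difference of two consecutive remainders, so no separate estimate
  for it is required.\<close>

lemma Cr_le_taylor_form:
  fixes u :: "real^'n::finite \<Rightarrow> real"
  assumes K: "\<And>N. Cr_le (ball 0 1) r (taylor_rem N u) (K / 4 ^ N)"
  shows "Cr_le (ball 0 1) r (\<lambda>x. taylor_form k u 0 x / fact k) (2 * K / 4 ^ k)"
proof -
  have "Cr_le (ball 0 1) r (\<lambda>x. taylor_rem k u x - taylor_rem (Suc k) u x) (K / 4 ^ k + K / 4 ^ Suc k)"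
    by (intro Cr_le_diff K) simp
  moreover have "K / 4 ^ k + K / 4 ^ Suc k \<le> 2 * K / 4 ^ k"
    using Cr_le_nonneg [OF K [of k]] by (simp add: field_simps)
  ultimately show ?thesis
    by (auto simp: taylor_rem_def intro: Cr_le_mono)
qed

section \<open>Entire functions of the squared radius\<close>

definition entire_coeffs :: "(nat \<Rightarrow> real) \<Rightarrow> bool" where
  "entire_coeffs c \<longleftrightarrow> (\<forall>s. summable (\<lambda>j. c j * s ^ j))"

text \<open>A derivative produces the factor 2 \<mu> x_i and the series with coefficients
  \<open>diffs c\<close>, which is entire again, so the induction runs over all c. The bound is
  uniform in \<mu> because \<mu> becomes 1/N^2.\<close>

lemma Cr_le_powser:
  assumes "entire_coeffs c"
  shows "\<exists>K\<ge>0. \<forall>\<mu>. 0 \<le> \<mu> \<and> \<mu> \<le> 1 \<longrightarrow>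
    Cr_le (ball 0 1) r (\<lambda>x::real^'n::finite. \<Sum>j. c j * (\<mu> * (x \<bullet> x)) ^ j) K"
  using assms
proof (induction r arbitrary: c)
  case 0
  have "DERIV (\<lambda>s. \<Sum>j. c j * s ^ j) s :> (\<Sum>j. diffs c j * s ^ j)" for s
    using 0 unfolding entire_coeffs_def by (intro termdiffs_strong_converges_everywhere) blast
  then have "continuous_on {0..1} (\<lambda>s. \<Sum>j. c j * s ^ j)"
    by (intro continuous_at_imp_continuous_on ballI DERIV_isCont)
  then have "bounded ((\<lambda>s. \<Sum>j. c j * s ^ j) ` {0..1})"
    by (intro compact_imp_bounded compact_continuous_image) auto
  then obtain K where K: "K > 0" "\<And>s. s \<in> {0..1} \<Longrightarrow> \<bar>\<Sum>j. c j * s ^ j\<bar> \<le> K"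
    unfolding bounded_pos by auto
  have "\<mu> * (x \<bullet> x) \<in> {0..1}" if "0 \<le> \<mu>" "\<mu> \<le> 1" "x \<in> ball 0 1" for \<mu> and x :: "real^'n"
  proof -
    have "x \<bullet> x \<le> 1"
      using that by (simp add: dot_square_norm power_le_one)
    then show ?thesis
      using that by (simp add: mult_le_one)
  qed
  then show ?case
    using K by (intro exI [of _ K]) auto
next
  case (Suc r)
  let ?G = "\<lambda>c s. \<Sum>j. c j * s ^ j"
  obtain K where K: "K \<ge> 0" "\<And>\<mu>. 0 \<le> \<mu> \<Longrightarrow> \<mu> \<le> 1 \<Longrightarrow> Cr_le (ball 0 1) r (\<lambda>x::real^'n. ?G c (\<mu> * (x \<bullet> x))) K"
    using Suc.IH [OF Suc.prems] by blast
  have ediff: "entire_coeffs (diffs c)"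
    using Suc.prems termdiff_converges_all [of c] unfolding entire_coeffs_def by simp
  obtain L where L: "L \<ge> 0" "\<And>\<mu>. 0 \<le> \<mu> \<Longrightarrow> \<mu> \<le> 1 \<Longrightarrow> Cr_le (ball 0 1) r (\<lambda>x::real^'n. ?G (diffs c) (\<mu> * (x \<bullet> x))) L"
    using Suc.IH [OF ediff] by blast
  obtain X where X: "X \<ge> 0" "\<And>i. Cr_le (ball 0 1) r (\<lambda>x::real^'n. x $ i) X"
    using Cr_le_coord [of r] by blast
  have "Cr_le (ball 0 1) (Suc r) (\<lambda>x::real^'n. ?G c (\<mu> * (x \<bullet> x))) (K + (\<Sum>i\<in>(UNIV::'n set). 2 * (X * L)))"
    if "0 \<le> \<mu>" "\<mu> \<le> 1" for \<mu>
  proof (rule Cr_leI [OF _ K(2) [OF that]])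
    have d: "((\<lambda>x::real^'n. ?G c (\<mu> * (x \<bullet> x))) has_derivative
        (\<lambda>h. ?G (diffs c) (\<mu> * (x \<bullet> x)) * (\<mu> * (2 * (x \<bullet> h))))) (at x)" for x
    proof -
      have "((\<lambda>x::real^'n. \<mu> * (x \<bullet> x)) has_derivative (\<lambda>h. \<mu> * (2 * (x \<bullet> h)))) (at x)"
        by (rule derivative_eq_intros refl)+ (simp add: inner_commute)
      moreover have "(?G c has_derivative (\<lambda>h. ?G (diffs c) (\<mu> * (x \<bullet> x)) * h)) (at (\<mu> * (x \<bullet> x)))"
        using Suc.prems termdiffs_strong_converges_everywhere [of c]
        unfolding entire_coeffs_def has_field_derivative_def by simp
      ultimately show ?thesis
        using diff_chain_at [of "\<lambda>x. \<mu> * (x \<bullet> x)" _ x "?G c"] by (simp add: o_def)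
    qed
    then show "(\<lambda>x::real^'n. ?G c (\<mu> * (x \<bullet> x))) differentiable (at x)" for x
      unfolding differentiable_def by blast
    fix i
    have eq: "pd [i] (\<lambda>x::real^'n. ?G c (\<mu> * (x \<bullet> x))) = (\<lambda>x. 2 * \<mu> * (x $ i * ?G (diffs c) (\<mu> * (x \<bullet> x))))"
      using pd_has_derivative [OF d] by (auto simp: inner_axis)
    have "Cr_le (ball 0 1) r (pd [i] (\<lambda>x::real^'n. ?G c (\<mu> * (x \<bullet> x)))) (\<bar>2 * \<mu>\<bar> * (X * L))"
      unfolding eq by (intro Cr_le_cmult Cr_le_mult X L that) auto
    moreover have "\<bar>2 * \<mu>\<bar> * (X * L) \<le> 2 * (X * L)"
      using that X L by (intro mult_right_mono) auto
    ultimately show "Cr_le (ball 0 1) r (pd [i] (\<lambda>x::real^'n. ?G c (\<mu> * (x \<bullet> x)))) (2 * (X * L))"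
      by (rule Cr_le_mono)
  qed simp
  moreover have "0 \<le> K + (\<Sum>i\<in>(UNIV::'n set). 2 * (X * L))"
    using K X L by (intro add_nonneg_nonneg sum_nonneg) auto
  ultimately show ?case by blast
qed

text \<open>Removing the constant term leaves a factor \<mu> |x|^2. The linear rate in \<mu> = 1/N^2
  is what survives raising to the N-th power.\<close>

lemma Cr_le_powser_minus_const:
  assumes "entire_coeffs c"
  shows "\<exists>K\<ge>0. \<forall>\<mu>. 0 \<le> \<mu> \<and> \<mu> \<le> 1 \<longrightarrow>
    Cr_le (ball 0 1) r (\<lambda>x::real^'n::finite. (\<Sum>j. c j * (\<mu> * (x \<bullet> x)) ^ j) - c 0) (K * \<mu>)"
proof -
  have shift: "entire_coeffs (\<lambda>j. c (Suc j))"
    using assms by (simp add: entire_coeffs_def summable_powser_split_head)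
  obtain K where K: "K \<ge> 0" "\<And>\<mu>. 0 \<le> \<mu> \<Longrightarrow> \<mu> \<le> 1 \<Longrightarrow>
      Cr_le (ball 0 1) r (\<lambda>x::real^'n. \<Sum>j. c (Suc j) * (\<mu> * (x \<bullet> x)) ^ j) K"
    using Cr_le_powser [OF shift, of r, where 'n = 'n] by blast
  obtain X where X: "X \<ge> 0" "\<And>i. Cr_le (ball 0 1) r (\<lambda>x::real^'n. x $ i) X"
    using Cr_le_coord [of r] by blast
  have "Cr_le (ball 0 1) r (\<lambda>x::real^'n. (\<Sum>j. c j * (\<mu> * (x \<bullet> x)) ^ j) - c 0) (K * (\<Sum>i\<in>(UNIV::'n set). X * X) * \<mu>)"
    if \<mu>: "0 \<le> \<mu>" "\<mu> \<le> 1" for \<mu>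
  proof -
    have "Cr_le (ball 0 1) r (\<lambda>x::real^'n. (\<Sum>j. c (Suc j) * (\<mu> * (x \<bullet> x)) ^ j) * (\<mu> * (\<Sum>i\<in>UNIV. x $ i * x $ i)))
        (K * (\<bar>\<mu>\<bar> * (\<Sum>i\<in>(UNIV::'n set). X * X)))"
      by (intro Cr_le_cmult Cr_le_mult Cr_le_sum X K(2) \<mu> open_ball)
    moreover have "(\<Sum>j. c (Suc j) * s ^ j) * s = (\<Sum>j. c j * s ^ j) - c 0" for s
      using powser_split_head(2) [of c s] assms by (simp add: entire_coeffs_def)
    ultimately have "Cr_le (ball 0 1) r (\<lambda>x::real^'n. (\<Sum>j. c j * (\<mu> * (x \<bullet> x)) ^ j) - c 0)
        (K * (\<bar>\<mu>\<bar> * (\<Sum>i\<in>(UNIV::'n set). X * X)))"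
      by (simp only: inner_vec_def inner_real_def)
    then show ?thesis
      using \<mu> by (simp only: abs_of_nonneg mult_ac)
  qed
  moreover have "0 \<le> K * (\<Sum>i\<in>(UNIV::'n set). X * X)"
    using K X by (intro mult_nonneg_nonneg sum_nonneg) auto
  ultimately show ?thesis by blast
qed

section \<open>Convergence in the chart\<close>

text \<open>$\cos \sqrt s$ and $\sin \sqrt s / \sqrt s$ as entire functions of $s$: composed with $|x|^2$ they
  are smooth at the origin.\<close>

definition cos_sqrt :: "real \<Rightarrow> real" where
  "cos_sqrt s = (\<Sum>j. (- 1) ^ j / fact (2 * j) * s ^ j)"

definition sinc_sqrt :: "real \<Rightarrow> real" where
  "sinc_sqrt s = (\<Sum>j. (- 1) ^ j / fact (2 * j + 1) * s ^ j)"

lemma entire_coeffs_le_fact: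
  assumes "\<And>j. \<bar>c j\<bar> \<le> 1 / fact j"
  shows "entire_coeffs c"
  unfolding entire_coeffs_def
proof
  fix s :: real
  show "summable (\<lambda>j. c j * s ^ j)"
  proof (rule summable_comparison_test')
    show "summable (\<lambda>j. inverse (fact j) * \<bar>s\<bar> ^ j)"
      by (rule summable_exp)
    show "norm (c j * s ^ j) \<le> inverse (fact j) * \<bar>s\<bar> ^ j" for j
      using mult_right_mono [OF assms [of j], of "\<bar>s\<bar> ^ j"]
      by (simp only: real_norm_def abs_mult power_abs inverse_eq_divide zero_le_power abs_ge_zero)
  qed
qed

lemma entire_coeffs_cos_sqrt: "entire_coeffs (\<lambda>j. (- 1) ^ j / fact (2 * j))"
  by (rule entire_coeffs_le_fact) (simp add: power_abs abs_divide frac_le fact_mono)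

lemma entire_coeffs_sinc_sqrt: "entire_coeffs (\<lambda>j. (- 1) ^ j / fact (2 * j + 1))"
proof (rule entire_coeffs_le_fact)
  fix j
  have "(fact j :: real) \<le> fact (2 * j + 1)"
    by (rule fact_mono) simp
  then show "\<bar>(- 1) ^ j / fact (2 * j + 1)\<bar> \<le> 1 / (fact j :: real)"
    by (simp add: power_abs abs_divide frac_le del: fact_Suc)
qed

lemma cos_sqrt_square: "cos_sqrt (t\<^sup>2) = cos t"
  using cos_paired [of t] by (simp add: cos_sqrt_def sums_iff power_mult)

text \<open>Written as a product instead of a quotient, so that t = 0 is included.\<close>

lemma sinc_sqrt_square: "sinc_sqrt (t\<^sup>2) * t = sin t"
proof -
  have "summable (\<lambda>j. (- 1) ^ j / fact (2 * j + 1) * (t\<^sup>2) ^ j)"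
    using entire_coeffs_sinc_sqrt by (simp add: entire_coeffs_def)
  then have "sinc_sqrt (t\<^sup>2) * t = (\<Sum>j. (- 1) ^ j / fact (2 * j + 1) * (t\<^sup>2) ^ j * t)"
    unfolding sinc_sqrt_def by (rule suminf_mult2)
  also have "\<dots> = (\<Sum>j. (- 1) ^ j / fact (2 * j + 1) * t ^ (2 * j + 1))"
    by (simp add: power_mult mult.assoc mult.commute [of t])
  also have "\<dots> = sin t"
    using sin_paired [of t] by (simp only: sums_iff)
  finally show ?thesis .
qed

text \<open>This is N(N-1)...(N-k+1) / N^k, the quotient of the rescaled binomial weight and the
  Taylor weight 1/k!.\<close>

definition falling_ratio :: "nat \<Rightarrow> nat \<Rightarrow> real" where
  "falling_ratio N k = real (N choose k) * fact k / real N ^ k"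

text \<open>Passing from k to k + 1 multiplies the ratio by 1 - k/N, a loss of at most k/N. Beyond N
  the claimed bound is at least 1 and holds trivially.\<close>

lemma falling_ratio_bounds:
  assumes "N > 0"
  shows "0 \<le> falling_ratio N k" "falling_ratio N k \<le> 1" "1 - falling_ratio N k \<le> (real k)\<^sup>2 / real N"
proof -
  show *: "0 \<le> falling_ratio N k" for k by (simp add: falling_ratio_def)
  have "real ((N choose k) * fact k) \<le> real (N ^ k)" for k
    by (rule of_nat_mono [OF binomial_fact_pow])
  then show **: "falling_ratio N k \<le> 1" for k
    using assms by (simp add: falling_ratio_def)
  show "1 - falling_ratio N k \<le> (real k)\<^sup>2 / real N"
  proof (induction k)
    case (Suc k)
    show ?case
    proof (cases "k \<le> N")
      case True
      have "real (Suc k * (N choose Suc k)) = real ((N - k) * (N choose k))"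
        by (metis binomial_absorb_comp binomial_absorption)
      then have eq: "real (N choose Suc k) * (1 + real k) = (real N - real k) * real (N choose k)"
        using True by (simp add: of_nat_diff algebra_simps)
      have "falling_ratio N (Suc k) = (real (N choose Suc k) * (1 + real k)) * fact k / (real N * real N ^ k)"
        by (simp add: falling_ratio_def mult_ac)
      also have "\<dots> = falling_ratio N k * ((real N - real k) / real N)"
        unfolding eq by (simp add: falling_ratio_def mult_ac)
      also have "\<dots> = falling_ratio N k - falling_ratio N k * (real k / real N)"
        using assms by (simp add: field_simps)
      finally have "1 - falling_ratio N (Suc k) \<le> (real k)\<^sup>2 / real N + 1 * (real k / real N)"
        using Suc.IH mult_right_mono [OF ** [of k], of "real k / real N"] by simp
      also have "\<dots> \<le> (real (Suc k))\<^sup>2 / real N"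
        using assms by (simp add: field_simps power2_eq_square)
      finally show ?thesis .
    next
      case False
      then have "real N \<le> real (Suc k)" by simp
      also have "\<dots> \<le> (real (Suc k))\<^sup>2"
        by (rule self_le_power) auto
      finally have "1 \<le> (real (Suc k))\<^sup>2 / real N"
        using assms by (simp only: le_divide_eq_1_pos of_nat_0_less_iff)
      then show ?thesis using * [of "Suc k"] by linarith
    qed
  qed (simp add: falling_ratio_def)
qed

text \<open>The shape of \<open>sphere_harmonic\<close> in the rescaled chart. The factor N^-k from
  the argument x/N is absorbed into \<open>falling_ratio\<close>, so that each summand is visibly a
  Taylor term times something close to 1.\<close>

definition chart_harmonic :: "nat \<Rightarrow> (real^'n::finite \<Rightarrow> real) \<Rightarrow> real^'n \<Rightarrow> real" where
  "chart_harmonic N u x = (\<Sum>k\<le>N. falling_ratio N k *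
     (cos_sqrt (1 / (real N)\<^sup>2 * (x \<bullet> x)) ^ (N - k) * sinc_sqrt (1 / (real N)\<^sup>2 * (x \<bullet> x)) ^ k) *
     (taylor_form k u 0 x / fact k))"

lemma sum_square_over_power_le: "(\<Sum>k\<le>N. (real k)\<^sup>2 / 4 ^ k) \<le> 4"
proof -
  \<comment> \<open>Half of the decay of 4^-k is spent on k^2; a geometric series of ratio 1/2
    remains.\<close>
  have sq: "(real k)\<^sup>2 \<le> 2 * 2 ^ k" for k :: nat
  proof (induction k)
    case (Suc k)
    show ?case
    proof (cases "k \<le> 2")
      case True
      then have "k = 0 \<or> k = 1 \<or> k = 2" by auto
      then show ?thesis by auto
    next
      case False
      then have "3 \<le> real k" by simp
      then have "3 * real k \<le> real k * real k"
        by (intro mult_right_mono) auto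
      with \<open>3 \<le> real k\<close> have "1 + 2 * real k \<le> real k * real k"
        by linarith
      then have "(real (Suc k))\<^sup>2 \<le> 2 * (real k)\<^sup>2"
        by (simp add: power2_eq_square algebra_simps)
      then show ?thesis using Suc by simp
    qed
  qed simp
  have "(\<Sum>k\<le>N. (real k)\<^sup>2 / 4 ^ k) \<le> (\<Sum>k\<le>N. 2 * (1 / 2) ^ k)"
  proof (rule sum_mono)
    fix k
    have "(real k)\<^sup>2 / 4 ^ k \<le> 2 * 2 ^ k / 4 ^ k"
      using sq by (intro divide_right_mono) auto
    also have "\<dots> = 2 * (2 / 4) ^ k" unfolding power_divide by simp
    finally show "(real k)\<^sup>2 / 4 ^ k \<le> 2 * (1 / 2) ^ k" by simp
  qed
  also have "\<dots> \<le> 4"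
    unfolding sum_distrib_left [symmetric] by (simp add: sum_gp0)
  finally show ?thesis .
qed

lemma sum_over_power_le: "(\<Sum>k\<le>N. 1 / 4 ^ k :: real) \<le> 2"
proof -
  have "(\<Sum>k\<le>N. 1 / 4 ^ k :: real) = (\<Sum>k\<le>N. (1 / 4) ^ k)"
    by (simp add: power_divide)
  also have "\<dots> \<le> 2"
    by (simp add: sum_gp0) (rule order_trans [of _ 0], simp_all)
  finally show ?thesis .
qed

text \<open>Three errors vanish separately: the Taylor tail beyond degree N, the deviation of
  \<open>falling_ratio\<close> from 1, and the deviation of the powers of cos and sinc from 1. The
  last two are multiplied by terms of size 4^-k, hence summed with constants independent of
  N.\<close>

lemma Cr_le_chart_harmonic:
  fixes u :: "real^'n::finite \<Rightarrow> real"
  assumes u: "helmholtz u" and "\<delta> > 0"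
  shows "\<forall>\<^sub>F N in sequentially. Cr_le (ball 0 1) r (\<lambda>x. u x - chart_harmonic N u x) \<delta>"
proof -
  obtain K where K: "\<And>N. Cr_le (ball 0 1) r (taylor_rem N u) (K / 4 ^ N)"
    using Cr_le_taylor_rem [OF u] by blast
  have "K \<ge> 0" using Cr_le_nonneg [OF K [of 0]] by simp
  obtain \<kappa>1 where \<kappa>1: "\<kappa>1 \<ge> 0" "\<And>\<mu>. 0 \<le> \<mu> \<Longrightarrow> \<mu> \<le> 1 \<Longrightarrow>
      Cr_le (ball 0 1) r (\<lambda>x::real^'n. cos_sqrt (\<mu> * (x \<bullet> x)) - 1) (\<kappa>1 * \<mu>)"
    using Cr_le_powser_minus_const [OF entire_coeffs_cos_sqrt, of r, where 'n = 'n]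
    unfolding cos_sqrt_def by auto
  obtain \<kappa>2 where \<kappa>2: "\<kappa>2 \<ge> 0" "\<And>\<mu>. 0 \<le> \<mu> \<Longrightarrow> \<mu> \<le> 1 \<Longrightarrow>
      Cr_le (ball 0 1) r (\<lambda>x::real^'n. sinc_sqrt (\<mu> * (x \<bullet> x)) - 1) (\<kappa>2 * \<mu>)"
    using Cr_le_powser_minus_const [OF entire_coeffs_sinc_sqrt, of r, where 'n = 'n]
    unfolding sinc_sqrt_def by auto
  define \<kappa> where "\<kappa> = max \<kappa>1 \<kappa>2"
  define E where "E = (\<lambda>N. exp (\<kappa> / real N) - 1)"
  define T where "T = (\<lambda>N. K / 4 ^ Suc N + (8 * K / real N + 4 * K * E N))"
  have bound: "Cr_le (ball 0 1) r (\<lambda>x. u x - chart_harmonic N u x) (T N)" if "N > 0" for N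
  proof -
    define \<mu> where "\<mu> = 1 / (real N)\<^sup>2"
    have \<mu>: "0 \<le> \<mu>" "\<mu> \<le> 1"
      using that by (auto simp: \<mu>_def divide_le_eq_1 one_le_power)
    \<comment> \<open>A common bound for both factors. Since q^(N-k) q^k = q^N, the error of the
      mixed power does not depend on k, and q^N \<le> exp(\<kappa>/N) because \<mu> = 1/N^2.\<close>
    define q where "q = 1 + \<kappa> * \<mu>"
    define c s where "c = (\<lambda>x::real^'n. cos_sqrt (\<mu> * (x \<bullet> x)))" and "s = (\<lambda>x::real^'n. sinc_sqrt (\<mu> * (x \<bullet> x)))"
    have c: "Cr_le (ball 0 1) r (\<lambda>x. c x - 1) (q - 1)"
      using \<kappa>1(2) [OF \<mu>] unfolding c_def q_def \<kappa>_def
      by (rule Cr_le_mono) (use \<mu> in \<open>simp add: mult_right_mono\<close>)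
    have s: "Cr_le (ball 0 1) r (\<lambda>x. s x - 1) (q - 1)"
      using \<kappa>2(2) [OF \<mu>] unfolding s_def q_def \<kappa>_def
      by (rule Cr_le_mono) (use \<mu> in \<open>simp add: mult_right_mono\<close>)
    have q: "q ^ N - 1 \<le> E N"
    proof -
      have "q ^ N \<le> exp (\<kappa> * \<mu>) ^ N"
        using \<mu> \<kappa>1(1) unfolding q_def by (intro power_mono) (auto simp: \<kappa>_def max_def intro!: add_nonneg_nonneg)
      also have "\<dots> = exp (\<kappa> / real N)"
        using that by (simp add: exp_of_nat_mult [symmetric] \<mu>_def power2_eq_square)
      finally show ?thesis by (simp add: E_def)
    qed
    define W where "W = (\<lambda>k x. c x ^ (N - k) * s x ^ k)"
    have W: "Cr_le (ball 0 1) r (\<lambda>x. W k x - 1) (E N)" if "k \<le> N" for k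
    proof -
      have "Cr_le (ball 0 1) r (\<lambda>x. W k x - 1) (q ^ (N - k) * q ^ k - 1)"
        unfolding W_def by (intro Cr_le_mult_minus_one Cr_le_power_minus_one c s open_ball)
      then show ?thesis
        using q that by (auto simp: power_add [symmetric] intro: Cr_le_mono)
    qed
    let ?a = "falling_ratio N"
    \<comment> \<open>The defect 1 - a W of a summand is split as (1 - a) - a (W - 1), one part for
      each source of error.\<close>
    have summand: "Cr_le (ball 0 1) r (\<lambda>x. ((1 - ?a k) - ?a k * (W k x - 1)) * (taylor_form k u 0 x / fact k))
        (((real k)\<^sup>2 / real N + E N) * (2 * K / 4 ^ k))" if "k \<le> N" for k
    proof (rule Cr_le_mult [OF open_ball _ Cr_le_taylor_form [OF K]])
      note a = falling_ratio_bounds [OF \<open>N > 0\<close>, of k]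
      have "Cr_le (ball 0 1) r (\<lambda>x. (1 - ?a k) - ?a k * (W k x - 1)) (\<bar>1 - ?a k\<bar> + \<bar>?a k\<bar> * E N)"
        by (intro Cr_le_diff Cr_le_const Cr_le_cmult W that open_ball) simp
      moreover have "\<bar>1 - ?a k\<bar> + \<bar>?a k\<bar> * E N \<le> (real k)\<^sup>2 / real N + 1 * E N"
        using a Cr_le_nonneg [OF W [OF that]] by (intro add_mono mult_right_mono) auto
      ultimately show "Cr_le (ball 0 1) r (\<lambda>x. (1 - ?a k) - ?a k * (W k x - 1)) ((real k)\<^sup>2 / real N + E N)"
        by (auto intro: Cr_le_mono)
    qed
    have "Cr_le (ball 0 1) r
        (\<lambda>x. taylor_rem (Suc N) u x + (\<Sum>k\<le>N. ((1 - ?a k) - ?a k * (W k x - 1)) * (taylor_form k u 0 x / fact k)))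
        (K / 4 ^ Suc N + (\<Sum>k\<le>N. ((real k)\<^sup>2 / real N + E N) * (2 * K / 4 ^ k)))"
      by (intro Cr_le_add Cr_le_sum K summand open_ball) simp
    moreover have "taylor_rem (Suc N) u x + (\<Sum>k\<le>N. ((1 - ?a k) - ?a k * (W k x - 1)) * (taylor_form k u 0 x / fact k))
        = u x - chart_harmonic N u x" for x
    proof -
      have "(\<Sum>k\<le>N. ((1 - ?a k) - ?a k * (W k x - 1)) * (taylor_form k u 0 x / fact k))
          = (\<Sum>k\<le>N. taylor_form k u 0 x / fact k) - chart_harmonic N u x"
        unfolding chart_harmonic_def W_def c_def s_def \<mu>_def sum_subtractf [symmetric]
        by (rule sum.cong) (simp_all add: algebra_simps)
      then show ?thesis
        by (simp add: taylor_rem_def lessThan_Suc_atMost)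
    qed
    moreover have "(\<Sum>k\<le>N. ((real k)\<^sup>2 / real N + E N) * (2 * K / 4 ^ k)) \<le> 8 * K / real N + 4 * K * E N"
    proof -
      have "(\<Sum>k\<le>N. ((real k)\<^sup>2 / real N + E N) * (2 * K / 4 ^ k))
          = (2 * K / real N) * (\<Sum>k\<le>N. (real k)\<^sup>2 / 4 ^ k) + (2 * K * E N) * (\<Sum>k\<le>N. 1 / 4 ^ k)"
        unfolding sum_distrib_left sum.distrib [symmetric] by (rule sum.cong) (simp_all add: field_simps)
      also have "\<dots> \<le> (2 * K / real N) * 4 + (2 * K * E N) * 2"
        using \<open>K \<ge> 0\<close> Cr_le_nonneg [OF W [of 0]]
        by (intro add_mono mult_left_mono sum_square_over_power_le sum_over_power_le) auto
      finally show ?thesis by simp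
    qed
    ultimately show ?thesis
      unfolding T_def by (auto intro: Cr_le_mono)
  qed
  have "T \<longlonglongrightarrow> 0 + (0 + 4 * K * (exp 0 - 1))"
    unfolding T_def E_def
  proof (intro tendsto_intros)
    have "(\<lambda>N. K * (1 / 4) ^ Suc N) \<longlonglongrightarrow> K * 0"
      by (intro tendsto_intros LIMSEQ_Suc LIMSEQ_power_zero) simp
    then show "(\<lambda>N. K / 4 ^ Suc N) \<longlonglongrightarrow> 0"
      by (simp add: power_divide)
  qed
  then have "\<forall>\<^sub>F N in sequentially. T N < \<delta>"
    using order_tendstoD(2) \<open>\<delta> > 0\<close> by fastforce
  with eventually_gt_at_top [of 0] show ?thesis
    by eventually_elim (use bound Cr_le_mono less_imp_le in blast)
qed

section \<open>The spherical harmonic attached to a Helmholtz solution\<close>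

lemma pd_compose_linear_right:
  fixes f :: "real^'n::finite \<Rightarrow> real" and A :: "real^'k::finite \<Rightarrow> real^'n"
  assumes "bounded_linear A" "f differentiable (at (A p))"
  shows "pd [a] (\<lambda>p. f (A p)) p = (\<Sum>i\<in>UNIV. A (axis a 1) $ i * pd [i] f (A p))"
proof -
  have "(A has_derivative A) (at p)"
    by (rule bounded_linear_imp_has_derivative [OF assms(1)])
  from pd_has_derivative [OF diff_chain_at [OF this has_derivative_pd [OF assms(2)]], of a]
  show ?thesis by (simp add: o_def)
qed

lemma smooth_on_compose_linear_right:
  fixes f :: "real^'n::finite \<Rightarrow> real" and A :: "real^'k::finite \<Rightarrow> real^'n"
  assumes A: "bounded_linear A" and f: "smooth_on UNIV f"
  shows "smooth_on UNIV (\<lambda>p. f (A p))"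
proof -
  have "diffk k UNIV (\<lambda>p. f (A p))" for k
    using f
  proof (induction k arbitrary: f)
    case (Suc k)
    have df: "f differentiable (at y)" for y
      using smooth_on_imp_differentiable [OF Suc.prems] by simp
    have "(\<lambda>p. f (A p)) differentiable (at p)" for p
      using diff_chain_at [OF bounded_linear_imp_has_derivative [OF A, of "at p"], of f] df [of "A p"]
      unfolding differentiable_def o_def by blast
    moreover have "diffk k UNIV (pd [a] (\<lambda>p. f (A p)))" for a
    proof -
      have "diffk k UNIV (\<lambda>p. A (axis a 1) $ i * pd [i] f (A p))" for i
        by (intro diffk_mult smooth_on_imp_diffk [OF smooth_on_const] Suc.IH smooth_on_pd Suc.prems open_UNIV)
      then have "diffk k UNIV (\<lambda>p. \<Sum>i\<in>I. A (axis a 1) $ i * pd [i] f (A p))" for I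
      proof (induction I rule: infinite_finite_induct)
        case (insert i I)
        then show ?case by (simp add: diffk_add)
      qed (simp_all add: smooth_on_imp_diffk [OF smooth_on_const])
      then show ?thesis
        by (simp add: pd_compose_linear_right [OF A df, abs_def])
    qed
    ultimately show ?case by simp
  qed simp
  then show ?thesis by (simp add: smooth_on_iff_diffk)
qed

lemma pd_sum_cmult:
  fixes f :: "'b \<Rightarrow> real^'n::finite \<Rightarrow> real"
  assumes "open S" "\<And>a. a \<in> A \<Longrightarrow> smooth_on S (f a)" "x \<in> S"
  shows "pd is (\<lambda>x. \<Sum>a\<in>A. c a * f a x) x = (\<Sum>a\<in>A. c a * pd is (f a) x)"
proof -
  have "pd is (\<lambda>x. \<Sum>a\<in>A. c a *\<^sub>R f a x) x = (\<Sum>a\<in>A. pd is (\<lambda>x. c a *\<^sub>R f a x) x)"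
    by (rule pd_list_sum [OF assms(1) _ assms(3)])
       (rule smooth_on_compose_linear [OF bounded_linear_scaleR_right assms(1,2)])
  also have "\<dots> = (\<Sum>a\<in>A. c a *\<^sub>R pd is (f a) x)"
    by (rule sum.cong [OF refl], rule pd_list_compose_linear [OF bounded_linear_scaleR_right assms(1) assms(2) assms(3)])
  finally show ?thesis by simp
qed

lemma lap_sum_cmult:
  fixes f :: "'b \<Rightarrow> real^'n::finite \<Rightarrow> real"
  assumes "open S" "\<And>a. a \<in> A \<Longrightarrow> smooth_on S (f a)" "x \<in> S"
  shows "lap (\<lambda>x. \<Sum>a\<in>A. c a * f a x) x = (\<Sum>a\<in>A. c a * lap (f a) x)"
proof -
  have "pd [i, i] (\<lambda>x. \<Sum>a\<in>A. c a * f a x) x = (\<Sum>a\<in>A. c a * pd [i, i] (f a) x)" for i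
    using assms by (rule pd_sum_cmult)
  then show ?thesis
    unfolding lap_def sum_distrib_left by (simp only:) (rule sum.swap)
qed

lemma lap_mult:
  fixes f g :: "real^'n::finite \<Rightarrow> real"
  assumes S: "open S" "x \<in> S" and f: "smooth_on S f" and g: "smooth_on S g"
  shows "lap (\<lambda>x. f x * g x) x = lap f x * g x + 2 * (\<Sum>i\<in>UNIV. pd [i] f x * pd [i] g x) + f x * lap g x"
proof -
  have d: "pd is f differentiable (at y)" "pd is g differentiable (at y)" if "y \<in> S" for "is" y
    using f g that by (auto simp: smooth_on_def)
  have "pd [i, i] (\<lambda>x. f x * g x) x = pd [i, i] f x * g x + 2 * (pd [i] f x * pd [i] g x) + f x * pd [i, i] g x" for i
  proof -
    have "pd [i] (pd [i] (\<lambda>x. f x * g x)) x = pd [i] (\<lambda>x. pd [i] f x * g x + f x * pd [i] g x) x"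
      using d [of _ "[]"] by (intro pd_cong [OF S(1) _ S(2)] pd_mult) auto
    also have "\<dots> = pd [i] (\<lambda>x. pd [i] f x * g x) x + pd [i] (\<lambda>x. f x * pd [i] g x) x"
      using d [OF S(2), of "[]"] d [OF S(2), of "[i]"] by (intro pd_add differentiable_mult) auto
    also have "\<dots> = pd [i] (pd [i] f) x * g x + 2 * (pd [i] f x * pd [i] g x) + f x * pd [i] (pd [i] g) x"
      using d [OF S(2), of "[]"] d [OF S(2), of "[i]"] by (simp add: pd_mult)
    finally show ?thesis by (simp add: pd_Cons [of i "[i]"])
  qed
  then show ?thesis
    by (simp add: lap_def sum.distrib sum_distrib_left sum_distrib_right)
qed

lemma pd_power:
  fixes f :: "real^'n::finite \<Rightarrow> real"
  assumes "f differentiable (at x)"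
  shows "pd [i] (\<lambda>x. f x ^ m) x = m * f x ^ (m - 1) * pd [i] f x"
proof (cases m)
  case (Suc k)
  have "pd [i] (\<lambda>x. f x ^ Suc k) x = Suc k * f x ^ k * pd [i] f x"
  proof (induction k)
    case (Suc k)
    have "(\<lambda>x. f x ^ Suc k) differentiable (at x)"
      by (intro differentiable_power assms)
    then have "pd [i] (\<lambda>x. f x * f x ^ Suc k) x = pd [i] f x * f x ^ Suc k + f x * pd [i] (\<lambda>x. f x ^ Suc k) x"
      by (rule pd_mult [OF assms])
    then show ?case using Suc by (simp add: algebra_simps)
  qed simp
  then show ?thesis using Suc by simp
qed simp

lemma taylor_form_euler:
  assumes "smooth_on UNIV u"
  shows "(\<Sum>i\<in>UNIV. y $ i * pd [i] (taylor_form k u 0) y) = k * taylor_form k u 0 y"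
proof (cases k)
  case 0
  have "taylor_form 0 u 0 = (\<lambda>x. u 0)" by auto
  then show ?thesis using 0 by simp
next
  case (Suc m)
  show ?thesis
    unfolding Suc pd_taylor_form [OF assms] taylor_form.simps sum_distrib_left
    by (rule sum.cong) (simp_all add: mult_ac)
qed

text \<open>Two derivatives lower the degree by two and leave a contraction with the Laplacian of u.
  For k < 2 the truncated index k - 2 is harmless, since the coefficient k (k - 1) is zero.\<close>

lemma lap_taylor_form:
  assumes u: "helmholtz u"
  shows "lap (taylor_form k u 0) y = - (real k * real (k - 1) * taylor_form (k - 2) u 0 y)"
proof -
  have s: "smooth_on UNIV (pd is u)" for "is"
    using u by (simp add: helmholtz_def smooth_on_pd)
  have z: "taylor_form 0 v 0 = (\<lambda>x. v 0)" for v :: "real^'a \<Rightarrow> real" by auto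
  have d: "pd [i] (taylor_form (Suc m) (pd is u) 0) = (\<lambda>x. Suc m *\<^sub>R taylor_form m (pd [i] (pd is u)) 0 x)" for i m "is"
    using pd_taylor_form [OF s] by auto
  have dd: "pd [i, i] (taylor_form (Suc m) u 0) x = Suc m * pd [i] (taylor_form m (pd [i] u) 0) x" for i m x
    using d [of i m "[]"] pd_list_compose_linear [OF bounded_linear_scaleR_right open_UNIV smooth_on_taylor_form UNIV_I,
      of "[i]" "Suc m" m "pd [i] u" 0 x] by (simp add: pd_Cons [of i "[i]"])
  consider "k = 0" | "k = 1" | m where "k = Suc (Suc m)"
    by (metis One_nat_def not0_implies_Suc)
  then show ?thesis
  proof cases
    case 1
    then show ?thesis by (simp add: lap_def z pd_Cons [of _ "[_]"])
  next
    case 2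
    then show ?thesis by (simp add: lap_def dd z del: taylor_form.simps)
  next
    case 3
    have "lap (taylor_form k u 0) y = (\<Sum>i\<in>UNIV. Suc (Suc m) * (Suc m * taylor_form m (pd [i] (pd [i] u)) 0 y))"
      using d [of _ m "[_]"] by (simp add: 3 lap_def dd del: taylor_form.simps)
    also have "\<dots> = - (Suc (Suc m) * (Suc m * taylor_form m u 0 y))"
      using taylor_form_laplacian [OF u, of m 0 y] by (simp add: sum_distrib_left [symmetric])
    finally show ?thesis by (simp add: 3)
  qed
qed

text \<open>The adjoint of L in coordinates. For a normal frame it is a left inverse of L that
  annihilates p0.\<close>

definition frame_coords :: "(real^'n::finite \<Rightarrow> real^'k::finite) \<Rightarrow> real^'k \<Rightarrow> real^'n" where
  "frame_coords L p = (\<chi> i. p \<bullet> L (axis i 1))"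

text \<open>The polynomial in (t, y) with t = p \<bullet> p0 and y =
  \<open>frame_coords L p\<close>. It lives on the whole ambient space, where Euler's identity and
  the flat Laplacian are available.\<close>

definition sphere_harmonic :: "nat \<Rightarrow> real^'k::finite \<Rightarrow> (real^'n::finite \<Rightarrow> real^'k) \<Rightarrow> (real^'n \<Rightarrow> real) \<Rightarrow> real^'k \<Rightarrow> real" where
  "sphere_harmonic N p0 L u p =
     (\<Sum>k\<le>N. real (N choose k) * ((p \<bullet> p0) ^ (N - k) * taylor_form k u 0 (frame_coords L p)))"

lemma sphere_harmonic_scaleR:
  "sphere_harmonic N p0 L u (c *\<^sub>R p) = c ^ N * sphere_harmonic N p0 L u p"
proof -
  have "frame_coords L (c *\<^sub>R p) = c *\<^sub>R frame_coords L p"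
    by (simp add: frame_coords_def vec_eq_iff)
  then have "((c *\<^sub>R p) \<bullet> p0) ^ (N - k) * taylor_form k u 0 (frame_coords L (c *\<^sub>R p))
      = c ^ N * ((p \<bullet> p0) ^ (N - k) * taylor_form k u 0 (frame_coords L p))" if "k \<le> N" for k
    using that by (simp only: taylor_form_scaleR inner_scaleR_left power_mult_distrib)
      (simp add: power_add [symmetric] mult_ac flip: mult.assoc [of "c ^ k" "c ^ (N - k)"])
  then show ?thesis
    unfolding sphere_harmonic_def sum_distrib_left by (intro sum.cong) (auto simp: mult.left_commute)
qed

lemma Suc_times_binomial_complement: "Suc k * (N choose Suc k) = (N - k) * (N choose k)"
  by (metis binomial_absorb_comp binomial_absorption)

text \<open>For k + 2 \<le> N both sides are N! / (k! (N-k-2)!), otherwise zero. The identity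
  matches the t-Laplacian of term k with the y-Laplacian of term k + 2.\<close>

lemma binomial_two_steps:
  "(N choose Suc (Suc k)) * (Suc (Suc k) * Suc k) = (N choose k) * ((N - k) * (N - k - 1))"
proof -
  have "(N choose Suc (Suc k)) * (Suc (Suc k) * Suc k) = Suc k * (Suc (Suc k) * (N choose Suc (Suc k)))"
    by (simp only: mult_ac)
  also have "\<dots> = (N - Suc k) * (Suc k * (N choose Suc k))"
    unfolding Suc_times_binomial_complement [of "Suc k"] by (simp only: mult_ac)
  also have "\<dots> = (N choose k) * ((N - k) * (N - k - 1))"
    unfolding Suc_times_binomial_complement by (simp add: mult_ac)
  finally show ?thesis .
qed

context
  fixes p0 :: "real^'k::finite" and L :: "real^'n::finite \<Rightarrow> real^'k"
  assumes frame: "normal_coord_frame p0 L"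
begin

lemma frame_inner: "L x \<bullet> L y = x \<bullet> y"
  using frame unfolding normal_coord_frame_def dot_norm by (metis linear_add)

lemma frame_p0: "p0 \<bullet> p0 = 1" "L x \<bullet> p0 = 0" "p0 \<bullet> L x = 0"
  using frame by (auto simp: normal_coord_frame_def dot_square_norm inner_commute)

lemma bounded_linear_frame_coords: "bounded_linear (frame_coords L)"
  unfolding linear_conv_bounded_linear [symmetric]
  by (rule linearI) (auto simp: frame_coords_def vec_eq_iff inner_add_left)

lemma frame_coords_axis: "frame_coords L (axis a 1) $ i = L (axis i 1) $ a"
  by (simp add: frame_coords_def inner_axis')

text \<open>The vectors L e_i are orthonormal, so the sum over ambient directions in the double
  chain rule collapses to the diagonal.\<close>

lemma lap_frame_coords:
  fixes f :: "real^'n \<Rightarrow> real"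
  assumes f: "smooth_on UNIV f"
  shows "lap (\<lambda>p. f (frame_coords L p)) p = lap f (frame_coords L p)"
proof -
  have df: "pd is f differentiable (at y)" for "is" y
    using f by (simp add: smooth_on_def)
  have 1: "pd [a] (\<lambda>p. g (frame_coords L p)) = (\<lambda>p. \<Sum>i\<in>UNIV. L (axis i 1) $ a * pd [i] g (frame_coords L p))"
    if "\<And>y. g differentiable (at y)" for g a
    using pd_compose_linear_right [OF bounded_linear_frame_coords that] by (auto simp: frame_coords_axis)
  have "pd [a, a] (\<lambda>p. f (frame_coords L p)) p = (\<Sum>i\<in>UNIV. \<Sum>j\<in>UNIV. (L (axis i 1) $ a * L (axis j 1) $ a) * pd [j] (pd [i] f) (frame_coords L p))" for a
  proof -
    have "pd [a] (pd [a] (\<lambda>p. f (frame_coords L p))) p = (\<Sum>i\<in>UNIV. L (axis i 1) $ a * pd [a] (\<lambda>p. pd [i] f (frame_coords L p)) p)"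
      using df [of "[]"] by (subst 1, simp, subst pd_sum_cmult [OF open_UNIV])
        (auto intro!: smooth_on_compose_linear_right bounded_linear_frame_coords smooth_on_pd f)
    then show ?thesis
      using df by (simp add: 1 pd_Cons [of a "[a]"] sum_distrib_left mult.assoc)
  qed
  then have "lap (\<lambda>p. f (frame_coords L p)) p = (\<Sum>a\<in>UNIV. \<Sum>i\<in>UNIV. \<Sum>j\<in>UNIV. (L (axis i 1) $ a * L (axis j 1) $ a) * pd [j] (pd [i] f) (frame_coords L p))"
    by (simp add: lap_def)
  also have "\<dots> = (\<Sum>i\<in>UNIV. \<Sum>j\<in>UNIV. \<Sum>a\<in>UNIV. (L (axis i 1) $ a * L (axis j 1) $ a) * pd [j] (pd [i] f) (frame_coords L p))"
    by (subst sum.swap) (intro sum.cong sum.swap refl)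
  also have "\<dots> = (\<Sum>i\<in>UNIV. \<Sum>j\<in>UNIV. (L (axis i 1) \<bullet> L (axis j 1)) * pd [j] (pd [i] f) (frame_coords L p))"
    by (simp add: inner_vec_def sum_distrib_right)
  also have "\<dots> = lap f (frame_coords L p)"
    unfolding frame_inner by (simp add: inner_axis_axis lap_def pd_Cons [of _ "[_]"] if_distrib [of "\<lambda>x. x * _"] cong: if_cong)
  finally show ?thesis .
qed

lemma smooth_on_frame_coords: "smooth_on UNIV f \<Longrightarrow> smooth_on UNIV (\<lambda>p. f (frame_coords L p) :: real)"
  by (rule smooth_on_compose_linear_right [OF bounded_linear_frame_coords])

lemma sum_pd_frame_coords:
  fixes f :: "real^'n \<Rightarrow> real"
  assumes "smooth_on UNIV f"
  shows "(\<Sum>a\<in>UNIV. q $ a * pd [a] (\<lambda>p. f (frame_coords L p)) p) = (\<Sum>i\<in>UNIV. frame_coords L q $ i * pd [i] f (frame_coords L p))"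
proof -
  have "(\<Sum>a\<in>UNIV. q $ a * pd [a] (\<lambda>p. f (frame_coords L p)) p) = (\<Sum>a\<in>UNIV. \<Sum>i\<in>UNIV. (q $ a * L (axis i 1) $ a) * pd [i] f (frame_coords L p))"
    using smooth_on_imp_differentiable [OF assms]
    by (simp add: pd_compose_linear_right [OF bounded_linear_frame_coords] frame_coords_axis sum_distrib_left mult.assoc)
  also have "\<dots> = (\<Sum>i\<in>UNIV. frame_coords L q $ i * pd [i] f (frame_coords L p))"
    by (subst sum.swap) (simp add: frame_coords_def inner_vec_def sum_distrib_right)
  finally show ?thesis .
qed

lemma smooth_on_inner: "smooth_on S (\<lambda>p. p \<bullet> p0)"
  by (intro smooth_on_linear bounded_linear_inner_left)

lemma pd_inner_power: "pd [a] (\<lambda>p. (p \<bullet> p0) ^ m) = (\<lambda>p. (m * p0 $ a) * (p \<bullet> p0) ^ (m - 1))"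
proof
  fix p
  have "pd [a] (\<lambda>p. p \<bullet> p0) p = p0 $ a"
    by (subst pd_linear [OF bounded_linear_inner_left]) (simp add: inner_axis')
  then show "pd [a] (\<lambda>p. (p \<bullet> p0) ^ m) p = (m * p0 $ a) * (p \<bullet> p0) ^ (m - 1)"
    using pd_power [OF smooth_on_imp_differentiable [OF smooth_on_inner UNIV_I]] by simp
qed

lemma lap_inner_power: "lap (\<lambda>p. (p \<bullet> p0) ^ m) p = real m * real (m - 1) * (p \<bullet> p0) ^ (m - 2)"
proof -
  have "pd [a] (\<lambda>p. (m * p0 $ a) *\<^sub>R (p \<bullet> p0) ^ (m - 1)) p
      = (m * p0 $ a) *\<^sub>R pd [a] (\<lambda>p. (p \<bullet> p0) ^ (m - 1)) p" for a
    by (rule pd_list_compose_linear [OF bounded_linear_scaleR_right open_UNIV smooth_on_power UNIV_I])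
       (auto intro: smooth_on_inner)
  then have "pd [a, a] (\<lambda>p. (p \<bullet> p0) ^ m) p = (p0 $ a * p0 $ a) * (real m * real (m - 1) * (p \<bullet> p0) ^ (m - 2))" for a
    by (simp add: pd_Cons [of a "[a]"] pd_inner_power diff_diff_left numeral_2_eq_2 mult_ac)
  then have "lap (\<lambda>p. (p \<bullet> p0) ^ m) p = (p0 \<bullet> p0) * (real m * real (m - 1) * (p \<bullet> p0) ^ (m - 2))"
    by (simp only: lap_def inner_vec_def inner_real_def sum_distrib_right)
  then show ?thesis by (simp add: frame_p0)
qed

lemma frame_coords_p0: "frame_coords L p0 = 0"
  by (simp add: frame_coords_def frame_p0 vec_eq_iff)

lemma smooth_on_summand: "smooth_on UNIV (\<lambda>p. (p \<bullet> p0) ^ m * taylor_form k u 0 (frame_coords L p))"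
  by (intro smooth_on_mult smooth_on_power smooth_on_inner smooth_on_frame_coords smooth_on_taylor_form open_UNIV)

lemma smooth_on_sphere_harmonic: "smooth_on UNIV (sphere_harmonic N p0 L u)"
  unfolding sphere_harmonic_def [abs_def]
  by (intro smooth_on_sum smooth_on_mult [OF _ smooth_on_const] smooth_on_summand open_UNIV)

text \<open>Homogeneity term by term: t contributes N - k and y contributes k. This evaluates the
  cross term when the polynomial is multiplied by |x|^-N.\<close>

lemma sphere_harmonic_euler:
  assumes u: "smooth_on UNIV u"
  shows "(\<Sum>a\<in>UNIV. p $ a * pd [a] (sphere_harmonic N p0 L u) p) = N * sphere_harmonic N p0 L u p"
proof -
  have s: "(\<Sum>a\<in>UNIV. p $ a * pd [a] (\<lambda>p. (p \<bullet> p0) ^ (N - k) * taylor_form k u 0 (frame_coords L p)) p)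
      = N * ((p \<bullet> p0) ^ (N - k) * taylor_form k u 0 (frame_coords L p))" if "k \<le> N" for k
  proof -
    let ?T = "\<lambda>p. taylor_form k u 0 (frame_coords L p)"
    have "pd [a] (\<lambda>p. (p \<bullet> p0) ^ (N - k) * ?T p) p
        = (real (N - k) * p0 $ a * (p \<bullet> p0) ^ (N - k - 1)) * ?T p + (p \<bullet> p0) ^ (N - k) * pd [a] ?T p" for a
      by (subst pd_mult) (auto simp: pd_inner_power intro!: smooth_on_imp_differentiable [of UNIV]
          smooth_on_power smooth_on_inner smooth_on_frame_coords smooth_on_taylor_form)
    then have "(\<Sum>a\<in>UNIV. p $ a * pd [a] (\<lambda>p. (p \<bullet> p0) ^ (N - k) * ?T p) p)
        = (\<Sum>a\<in>UNIV. p $ a * p0 $ a) * (real (N - k) * (p \<bullet> p0) ^ (N - k - 1) * ?T p)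
          + (p \<bullet> p0) ^ (N - k) * (\<Sum>a\<in>UNIV. p $ a * pd [a] ?T p)"
      by (simp add: sum.distrib sum_distrib_left sum_distrib_right algebra_simps)
    also have "\<dots> = real (N - k) * ((p \<bullet> p0) * (p \<bullet> p0) ^ (N - k - 1)) * ?T p + (p \<bullet> p0) ^ (N - k) * (k * ?T p)"
      unfolding sum_pd_frame_coords [OF smooth_on_taylor_form] taylor_form_euler [OF u]
      by (simp add: inner_vec_def)
    \<comment> \<open>At k = N the exponent N - k - 1 is truncated to 0, but the coefficient
      vanishes as well.\<close>
    also have "real (N - k) * ((p \<bullet> p0) * (p \<bullet> p0) ^ (N - k - 1)) = real (N - k) * (p \<bullet> p0) ^ (N - k)"
      by (cases "N - k") auto
    also have "real (N - k) = real N - real k"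
      using that by (rule of_nat_diff)
    finally show ?thesis by (simp add: algebra_simps)
  qed
  have "(\<Sum>a\<in>UNIV. p $ a * pd [a] (sphere_harmonic N p0 L u) p)
     = (\<Sum>a\<in>UNIV. \<Sum>k\<le>N. p $ a * (real (N choose k) * pd [a] (\<lambda>p. (p \<bullet> p0) ^ (N - k) * taylor_form k u 0 (frame_coords L p)) p))"
    unfolding sphere_harmonic_def [abs_def] by (simp add: pd_sum_cmult [OF open_UNIV smooth_on_summand UNIV_I] sum_distrib_left)
  also have "\<dots> = (\<Sum>k\<le>N. real (N choose k) * (\<Sum>a\<in>UNIV. p $ a * pd [a] (\<lambda>p. (p \<bullet> p0) ^ (N - k) * taylor_form k u 0 (frame_coords L p)) p))"
    by (subst sum.swap) (simp add: sum_distrib_left mult_ac)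
  also have "\<dots> = (\<Sum>k\<le>N. real (N choose k) * (N * ((p \<bullet> p0) ^ (N - k) * taylor_form k u 0 (frame_coords L p))))"
    using s by (intro sum.cong) auto
  also have "\<dots> = N * sphere_harmonic N p0 L u p"
    unfolding sphere_harmonic_def [abs_def] sum_distrib_left by (simp add: mult_ac)
  finally show ?thesis .
qed

lemma lap_sphere_harmonic:
  assumes u: "helmholtz u"
  shows "lap (sphere_harmonic N p0 L u) p = 0"
proof -
  let ?t = "p \<bullet> p0" and ?T = "\<lambda>k. taylor_form k u 0 (frame_coords L p)"
  \<comment> \<open>a collects the second derivatives in t, b those in y; the latter enter with a
    minus sign from the Helmholtz equation.\<close>
  define a where "a = (\<lambda>k. real ((N choose k) * ((N - k) * (N - k - 1))) * (?t ^ (N - k - 2) * ?T k))"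
  define b where "b = (\<lambda>k. real ((N choose k) * (k * (k - 1))) * (?t ^ (N - k) * ?T (k - 2)))"
  have "lap (\<lambda>p. (p \<bullet> p0) ^ (N - k) * taylor_form k u 0 (frame_coords L p)) p
      = real (N - k) * real (N - k - 1) * ?t ^ (N - k - 2) * ?T k - ?t ^ (N - k) * (real k * real (k - 1) * ?T (k - 2))" for k
  proof -
    let ?f = "\<lambda>p. (p \<bullet> p0) ^ (N - k)" and ?g = "\<lambda>p. taylor_form k u 0 (frame_coords L p)"
    \<comment> \<open>No cross term: the gradient of t is p0, which \<open>frame_coords\<close>
      sends to 0.\<close>
    have "(\<Sum>a\<in>UNIV. pd [a] ?f p * pd [a] ?g p) = (real (N - k) * ?t ^ (N - k - 1)) * (\<Sum>a\<in>UNIV. p0 $ a * pd [a] ?g p)"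
      by (simp add: pd_inner_power sum_distrib_left mult_ac)
    also have "\<dots> = 0"
      unfolding sum_pd_frame_coords [OF smooth_on_taylor_form] frame_coords_p0 by simp
    finally have z: "(\<Sum>a\<in>UNIV. pd [a] ?f p * pd [a] ?g p) = 0" .
    have "lap (\<lambda>p. ?f p * ?g p) p = lap ?f p * ?g p + 2 * (\<Sum>a\<in>UNIV. pd [a] ?f p * pd [a] ?g p) + ?f p * lap ?g p"
      by (intro lap_mult [OF open_UNIV UNIV_I] smooth_on_power smooth_on_inner smooth_on_frame_coords smooth_on_taylor_form open_UNIV)
    then show ?thesis
      unfolding z lap_inner_power lap_frame_coords [OF smooth_on_taylor_form] lap_taylor_form [OF u] by simp
  qed
  then have "real (N choose k) * lap (\<lambda>p. (p \<bullet> p0) ^ (N - k) * taylor_form k u 0 (frame_coords L p)) p = a k - b k" for k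
    by (simp only: a_def b_def of_nat_mult right_diff_distrib mult_ac)
  then have "lap (sphere_harmonic N p0 L u) p = (\<Sum>k\<le>N. a k - b k)"
    unfolding sphere_harmonic_def [abs_def] lap_sum_cmult [OF open_UNIV smooth_on_summand UNIV_I]
    by (simp only:)
  also have "\<dots> = (\<Sum>k\<le>N. a k) - (\<Sum>k\<le>N. b k)"
    by (rule sum_subtractf)
  \<comment> \<open>a k = b (k + 2), and the unmatched ends vanish: a at k = N - 1 and k = N, b at k
    = 0 and k = 1.\<close>
  also have "(\<Sum>k\<le>N. a k) = (\<Sum>k\<le>N. b k)"
  proof -
    consider "N = 0" | "N = 1" | M where "N = Suc (Suc M)"
      by (metis One_nat_def not0_implies_Suc)
    then show ?thesis
    proof cases
      case 3
      have "a k = b (Suc (Suc k))" if "k \<le> M" for k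
        using that binomial_two_steps [of N k] unfolding a_def b_def by (simp add: 3 del: binomial_Suc_Suc)
      then have "(\<Sum>k\<le>M. a k) = (\<Sum>k\<le>M. b (Suc (Suc k)))"
        by (intro sum.cong) auto
      moreover have "(\<Sum>k\<le>N. a k) = (\<Sum>k\<le>M. a k)"
        by (simp add: 3 a_def)
      moreover have "(\<Sum>k\<le>N. b k) = (\<Sum>k\<le>M. b (Suc (Suc k)))"
        unfolding 3 sum.atMost_Suc_shift by (simp add: b_def)
      ultimately show ?thesis by simp
    qed (auto simp: a_def b_def)
  qed
  finally show ?thesis by simp
qed

text \<open>At p0 we have t = 1 and y = 0, so only the constant Taylor term survives. This value
  certifies that the eigenfunction is not identically zero.\<close>

lemma sphere_harmonic_p0:
  "sphere_harmonic N p0 L u p0 = u 0"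
proof -
  have z: "taylor_form (Suc k) u 0 0 = 0" for k
    by simp
  have "(\<Sum>k\<le>N. real (N choose k) * taylor_form k u 0 0) = u 0"
    by (induction N) (simp_all add: sum.atMost_shift del: binomial_Suc_Suc)
  then show ?thesis
    unfolding sphere_harmonic_def [abs_def] frame_coords_p0 by (simp add: frame_p0)
qed

lemma sphere_harmonic_chart:
  assumes "N > 0"
  shows "sphere_harmonic N p0 L u (normal_coord_inv p0 L (x /\<^sub>R real N)) = chart_harmonic N u x"
proof -
  define y where "y = x /\<^sub>R real N"
  define p where "p = normal_coord_inv p0 L y"
  have nL: "norm (L y) = norm y" and lin: "linear L"
    using frame by (auto simp: normal_coord_frame_def)
  have sq: "(norm y)\<^sup>2 = 1 / (real N)\<^sup>2 * (x \<bullet> x)"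
    by (simp add: y_def dot_square_norm power_mult_distrib power_inverse divide_inverse)
  have p: "p = cos (norm y) *\<^sub>R p0 + (sin (norm y) / norm y) *\<^sub>R L y"
    by (simp add: p_def normal_coord_inv_def sphere_exp_def nL)
  have 1: "p \<bullet> p0 = cos_sqrt (1 / (real N)\<^sup>2 * (x \<bullet> x))"
    unfolding sq [symmetric] cos_sqrt_square p by (simp add: inner_add_left frame_p0)
  have "frame_coords L p = (sin (norm y) / norm y) *\<^sub>R y"
    by (simp add: frame_coords_def p inner_add_left frame_p0 frame_inner vec_eq_iff inner_axis)
  \<comment> \<open>At y = 0 the quotient is 0 by the convention for division, while sinc is 1; the
    factor y makes both sides zero.\<close>
  also have "\<dots> = sinc_sqrt ((norm y)\<^sup>2) *\<^sub>R y"
    unfolding sinc_sqrt_square [of "norm y", symmetric] by (cases "y = 0") auto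
  finally have 2: "frame_coords L p = (sinc_sqrt (1 / (real N)\<^sup>2 * (x \<bullet> x)) * inverse (real N)) *\<^sub>R x"
    unfolding sq by (simp add: y_def)
  have "sphere_harmonic N p0 L u p = chart_harmonic N u x"
    unfolding sphere_harmonic_def [abs_def] chart_harmonic_def 1 2 taylor_form_scaleR falling_ratio_def
    by (intro sum.cong) (simp_all add: power_mult_distrib power_inverse divide_inverse)
  then show ?thesis by (simp add: p_def y_def)
qed

end

section \<open>The eigenvalue equation on the sphere\<close>

lemma open_punctured: "open (UNIV - {0 :: real^'k::finite})"
  by (simp add: open_Diff)

lemma has_derivative_inverse_norm:
  fixes x :: "real^'k::finite"
  assumes "x \<noteq> 0"
  shows "((\<lambda>x. inverse (norm x)) has_derivative (\<lambda>h. - ((x \<bullet> h) * inverse (norm x) ^ 3))) (at x)"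
proof -
  have "((\<lambda>x. inverse (norm x)) has_derivative (\<lambda>h. - (inverse (norm x) * (h \<bullet> sgn x) * inverse (norm x)))) (at x)"
    using assms by (intro Deriv.has_derivative_inverse has_derivative_norm) auto
  then show ?thesis
    by (rule has_derivative_eq_rhs)
       (auto simp: sgn_div_norm inner_commute power3_eq_cube divide_inverse mult_ac)
qed

lemma pd_inverse_norm:
  "x \<in> UNIV - {0} \<Longrightarrow> pd [a] (\<lambda>x. inverse (norm x)) x = - (x $ a * inverse (norm x) ^ 3)"
  using pd_has_derivative [OF has_derivative_inverse_norm, of x a] by (simp add: inner_axis)

text \<open>The derivative of h = 1/|x| is -x_a h^3, a polynomial in the coordinates and h itself,
  so the induction on the order closes.\<close>

lemma smooth_on_inverse_norm: "smooth_on (UNIV - {0}) (\<lambda>x::real^'k::finite. inverse (norm x))"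
proof -
  let ?h = "\<lambda>x::real^'k. inverse (norm x)"
  have "diffk k (UNIV - {0}) ?h" for k
  proof (induction k)
    case (Suc k)
    have "diffk k (UNIV - {0}) (pd [a] ?h)" for a
    proof (rule diffk_cong [OF open_punctured])
      show "diffk k (UNIV - {0}) (\<lambda>x. (-1) * (x $ a * (?h x * (?h x * ?h x))))"
        by (intro diffk_mult open_punctured smooth_on_imp_diffk [OF smooth_on_const]
            smooth_on_imp_diffk [OF smooth_on_coord] Suc)
      show "(-1) * (x $ a * (?h x * (?h x * ?h x))) = pd [a] ?h x" if "x \<in> UNIV - {0}" for x
        using pd_inverse_norm [OF that] by (simp add: power3_eq_cube)
    qed
    moreover have "?h differentiable (at x)" if "x \<noteq> 0" for x
      using has_derivative_inverse_norm [OF that] unfolding differentiable_def by blast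
    ultimately show ?case by simp
  qed simp
  then show ?thesis by (simp add: smooth_on_iff_diffk)
qed

lemma pd_inverse_norm_power:
  assumes "x \<in> UNIV - {0}"
  shows "pd [a] (\<lambda>x. inverse (norm x) ^ N) x = - real N * (x $ a * inverse (norm x) ^ (N + 2))"
proof (cases N)
  case (Suc m)
  have "pd [a] (\<lambda>x. inverse (norm x) ^ N) x = N * inverse (norm x) ^ (N - 1) * - (x $ a * inverse (norm x) ^ 3)"
    using pd_power [OF smooth_on_imp_differentiable [OF smooth_on_inverse_norm assms]] pd_inverse_norm [OF assms] by metis
  also have "\<dots> = - real N * (x $ a * (inverse (norm x) ^ (N - 1) * inverse (norm x) ^ 3))"
    by (simp only: mult_ac mult_minus_left mult_minus_right)
  also have "inverse (norm x) ^ (N - 1) * inverse (norm x) ^ 3 = inverse (norm x) ^ (N + 2)"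
    by (simp add: Suc numeral_eq_Suc mult_ac)
  finally show ?thesis .
qed simp

text \<open>The radial formula for r^-N in dimension \<open>CARD('k)\<close>, evaluated at r =
  1.\<close>

lemma lap_inverse_norm_power:
  fixes x :: "real^'k::finite"
  assumes "norm x = 1"
  shows "lap (\<lambda>x. inverse (norm x) ^ N) x = N * (real N + 2 - CARD('k))"
proof -
  let ?h = "\<lambda>x::real^'k. inverse (norm x)"
  let ?S = "UNIV - {0 :: real^'k}"
  have x: "x \<in> ?S" using assms by auto
  have sm: "smooth_on ?S (\<lambda>x. ?h x ^ m)" for m
    by (intro smooth_on_power smooth_on_inverse_norm open_punctured)
  have "pd [a, a] (\<lambda>x. ?h x ^ N) x = - real N * (1 - (N + 2) * (x $ a * x $ a))" for a
  proof -
    have "pd [a] (pd [a] (\<lambda>x. ?h x ^ N)) x = pd [a] (\<lambda>x. (- real N) *\<^sub>R (x $ a * ?h x ^ (N + 2))) x"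
      using pd_inverse_norm_power by (intro pd_cong [OF open_punctured _ x]) simp
    also have "\<dots> = (- real N) *\<^sub>R pd [a] (\<lambda>x. x $ a * ?h x ^ (N + 2)) x"
      by (rule pd_list_compose_linear [OF bounded_linear_scaleR_right open_punctured _ x])
         (intro smooth_on_mult smooth_on_coord sm open_punctured)
    also have "pd [a] (\<lambda>x. x $ a * ?h x ^ (N + 2)) x = 1 * ?h x ^ (N + 2) + x $ a * (- real (N + 2) * (x $ a * ?h x ^ (N + 2 + 2)))"
      using pd_mult [OF smooth_on_imp_differentiable [OF smooth_on_coord x] smooth_on_imp_differentiable [OF sm x], of a a "N + 2"]
        pd_inverse_norm_power [OF x, of a "N + 2"] by (simp add: pd_coord)
    finally show ?thesis
      using assms by (simp add: pd_Cons [of a "[a]"] algebra_simps)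
  qed
  then have "lap (\<lambda>x. ?h x ^ N) x = - real N * (\<Sum>a\<in>UNIV. 1 - (real N + 2) * (x $ a * x $ a))"
    by (simp add: lap_def sum_distrib_left add.commute)
  also have "(\<Sum>a\<in>UNIV. 1 - (real N + 2) * (x $ a * x $ a)) = real CARD('k) - (real N + 2) * (x \<bullet> x)"
    by (simp add: sum_subtractf sum_distrib_left inner_vec_def)
  also have "x \<bullet> x = 1"
    using assms by (simp add: dot_square_norm)
  finally show ?thesis by (simp add: algebra_simps)
qed

context
  fixes p0 :: "real^'k::finite" and L :: "real^'n::finite \<Rightarrow> real^'k" and u :: "real^'n \<Rightarrow> real" and N :: nat
  assumes frame: "normal_coord_frame p0 L" and u: "helmholtz u"
begin

text \<open>Homogeneity of degree N turns the extension into a product, to which the Leibniz rule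
  for the Laplacian applies.\<close>

lemma sphere_ext_sphere_harmonic:
  "sphere_ext (sphere_harmonic N p0 L u) = (\<lambda>x. inverse (norm x) ^ N * sphere_harmonic N p0 L u x)"
  by (simp add: sphere_ext_def [abs_def] sphere_harmonic_scaleR)

lemma smooth_on_sphere_ext: "smooth_on (UNIV - {0}) (sphere_ext (sphere_harmonic N p0 L u))"
  unfolding sphere_ext_sphere_harmonic
  by (intro smooth_on_mult smooth_on_power smooth_on_inverse_norm open_punctured
      smooth_on_subset [OF smooth_on_sphere_harmonic [OF frame] subset_UNIV])

text \<open>With d = \<open>CARD('k)\<close>, the radial factor gives N(N + 2 - d), the cross term
  gives -2 N^2 by Euler's identity, and harmonicity removes the rest: together -N(N + d -
  2).\<close>

lemma sphere_lap_sphere_harmonic: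
  assumes p: "norm p = 1"
  shows "sphere_lap (sphere_harmonic N p0 L u) p = - (N * (real N + CARD('k) - 2)) * sphere_harmonic N p0 L u p"
proof -
  let ?H = "sphere_harmonic N p0 L u"
  have p': "p \<in> UNIV - {0}" using p by auto
  have "(\<Sum>a\<in>UNIV. pd [a] (\<lambda>x. inverse (norm x) ^ N) p * pd [a] ?H p) = - N * (\<Sum>a\<in>UNIV. p $ a * pd [a] ?H p)"
    by (simp add: pd_inverse_norm_power [OF p'] p sum_distrib_left mult.assoc sum_negf)
  also have "\<dots> = - N * (N * ?H p)"
    using u by (subst sphere_harmonic_euler [OF frame]) (auto simp: helmholtz_def)
  finally have grad: "(\<Sum>a\<in>UNIV. pd [a] (\<lambda>x. inverse (norm x) ^ N) p * pd [a] ?H p) = - N * (N * ?H p)" .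
  have "sphere_lap ?H p = lap (\<lambda>x. inverse (norm x) ^ N) p * ?H p
      + 2 * (\<Sum>a\<in>UNIV. pd [a] (\<lambda>x. inverse (norm x) ^ N) p * pd [a] ?H p) + inverse (norm p) ^ N * lap ?H p"
    unfolding sphere_lap_def sphere_ext_sphere_harmonic
    by (intro lap_mult [OF open_punctured p'] smooth_on_power smooth_on_inverse_norm open_punctured
      smooth_on_subset [OF smooth_on_sphere_harmonic [OF frame] subset_UNIV])
  then show ?thesis
    unfolding grad lap_inverse_norm_power [OF p] lap_sphere_harmonic [OF frame u]
    by (simp add: algebra_simps)
qed

end

section \<open>Vector-valued maps and smoothness in the chart\<close>

lemma smooth_on_vec:
  assumes "open S" "\<And>j. smooth_on S (f j)"
  shows "smooth_on S (\<lambda>x. (\<chi> j. f j x) :: real^'m::finite)"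
proof -
  have "smooth_on S (\<lambda>x. \<Sum>j\<in>UNIV. f j x *\<^sub>R (axis j 1 :: real^'m))"
    by (intro smooth_on_sum smooth_on_compose_linear [OF bounded_linear_scaleR_left] assms)
  moreover have "(\<Sum>j\<in>UNIV. f j x *\<^sub>R (axis j 1 :: real^'m)) = (\<chi> j. f j x)" for x
    using basis_expansion [of "\<chi> j. f j x"] by (simp add: scalar_mult_eq_scaleR)
  ultimately show ?thesis by simp
qed

lemma pd_vec_nth:
  fixes f :: "real^'n::finite \<Rightarrow> real^'m::finite"
  assumes "open S" "smooth_on S f" "x \<in> S"
  shows "pd is f x $ j = pd is (\<lambda>x. f x $ j) x"
  using pd_list_compose_linear [OF bounded_linear_vec_nth assms] by simp

lemma lap_vec_nth:
  fixes f :: "real^'n::finite \<Rightarrow> real^'m::finite"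
  assumes "open S" "smooth_on S f" "x \<in> S"
  shows "lap f x $ j = lap (\<lambda>x. f x $ j) x"
  by (simp add: lap_def pd_vec_nth [OF assms])

lemma Cr_le_imp_diffk: "Cr_le S r f K \<Longrightarrow> diffk r S f"
proof (induction r arbitrary: f K)
  case (Suc r)
  from Suc.prems show ?case
    by (rule Cr_leE) (use Suc.IH in auto)
qed simp

text \<open>\<open>Cr_le\<close> carries differentiability along, so having a bound of every order
  already contains smoothness.\<close>

lemma smooth_on_powser:
  assumes "entire_coeffs c" "0 \<le> \<mu>" "\<mu> \<le> 1"
  shows "smooth_on (ball 0 1) (\<lambda>x::real^'n::finite. \<Sum>j. c j * (\<mu> * (x \<bullet> x)) ^ j)"
  unfolding smooth_on_iff_diffk
proof
  fix k
  obtain K where "Cr_le (ball 0 1) k (\<lambda>x::real^'n. \<Sum>j. c j * (\<mu> * (x \<bullet> x)) ^ j) K"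
    using Cr_le_powser [OF assms(1), of k, where 'n = 'n] assms(2,3) by blast
  then show "diffk k (ball 0 1) (\<lambda>x::real^'n. \<Sum>j. c j * (\<mu> * (x \<bullet> x)) ^ j)"
    by (rule Cr_le_imp_diffk)
qed

lemma smooth_on_chart_harmonic:
  fixes u :: "real^'n::finite \<Rightarrow> real"
  assumes "N > 0"
  shows "smooth_on (ball 0 1) (chart_harmonic N u)"
proof -
  have \<mu>: "0 \<le> 1 / (real N)\<^sup>2" "1 / (real N)\<^sup>2 \<le> 1"
    using assms by (auto simp: divide_le_eq_1 one_le_power)
  have 1: "smooth_on (ball 0 1) (\<lambda>x::real^'n. cos_sqrt (1 / (real N)\<^sup>2 * (x \<bullet> x)))"
    using smooth_on_powser [OF entire_coeffs_cos_sqrt \<mu>] by (simp only: cos_sqrt_def)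
  have 2: "smooth_on (ball 0 1) (\<lambda>x::real^'n. sinc_sqrt (1 / (real N)\<^sup>2 * (x \<bullet> x)))"
    using smooth_on_powser [OF entire_coeffs_sinc_sqrt \<mu>] by (simp only: sinc_sqrt_def)
  have 3: "smooth_on (ball 0 1) (\<lambda>x. taylor_form k u 0 x / fact k)" for k
    using smooth_on_compose_linear [OF bounded_linear_divide open_ball
      smooth_on_subset [OF smooth_on_taylor_form subset_UNIV]] .
  show ?thesis
    unfolding chart_harmonic_def [abs_def]
    by (intro smooth_on_sum smooth_on_mult smooth_on_const smooth_on_power 1 2 3 open_ball)
qed

section \<open>An explicit Helmholtz solution that is nonzero at the origin\<close>

lemma pd_cos_coord:
  "pd [i] (\<lambda>x::real^'n::finite. cos (x $ j)) = (\<lambda>x. (if i = j then - 1 else 0) * sin (x $ j))"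
  "pd [i] (\<lambda>x::real^'n::finite. sin (x $ j)) = (\<lambda>x. (if i = j then 1 else 0) * cos (x $ j))"
  and differentiable_cos_coord:
  "(\<lambda>x::real^'n::finite. cos (x $ j)) differentiable (at x)"
  "(\<lambda>x::real^'n::finite. sin (x $ j)) differentiable (at x)"
proof -
  have c: "((\<lambda>x::real^'n. cos (x $ j)) has_derivative (\<lambda>h. h $ j * - sin (x $ j))) (at x)" for x
    by (auto intro!: derivative_eq_intros bounded_linear_imp_has_derivative bounded_linear_vec_nth)
  have s: "((\<lambda>x::real^'n. sin (x $ j)) has_derivative (\<lambda>h. h $ j * cos (x $ j))) (at x)" for x
    by (auto intro!: derivative_eq_intros bounded_linear_imp_has_derivative bounded_linear_vec_nth)
  show "pd [i] (\<lambda>x::real^'n. cos (x $ j)) = (\<lambda>x. (if i = j then - 1 else 0) * sin (x $ j))"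
    using pd_has_derivative [OF c] by (auto simp: axis_def)
  show "pd [i] (\<lambda>x::real^'n. sin (x $ j)) = (\<lambda>x. (if i = j then 1 else 0) * cos (x $ j))"
    using pd_has_derivative [OF s] by (auto simp: axis_def)
  show "(\<lambda>x::real^'n. cos (x $ j)) differentiable (at x)" "(\<lambda>x::real^'n. sin (x $ j)) differentiable (at x)"
    using c s unfolding differentiable_def by blast+
qed

lemma smooth_on_cos_coord:
  "smooth_on UNIV (\<lambda>x::real^'n::finite. cos (x $ j))" "smooth_on UNIV (\<lambda>x::real^'n::finite. sin (x $ j))"
proof -
  have "diffk k UNIV (\<lambda>x::real^'n. cos (x $ j)) \<and> diffk k UNIV (\<lambda>x::real^'n. sin (x $ j))" for k
  proof (induction k)
    case (Suc k)
    then show ?case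
      unfolding diffk.simps pd_cos_coord
      by (intro conjI allI ballI diffk_mult [OF open_UNIV] smooth_on_imp_diffk [OF smooth_on_const]
          differentiable_cos_coord) simp_all
  qed simp
  then show "smooth_on UNIV (\<lambda>x::real^'n. cos (x $ j))" "smooth_on UNIV (\<lambda>x::real^'n. sin (x $ j))"
    by (auto simp: smooth_on_iff_diffk)
qed

lemma helmholtz_cos_coord: "helmholtz (\<lambda>x::real^'n::finite. cos (x $ j))"
proof -
  have "pd [i, i] (\<lambda>x::real^'n. cos (x $ j)) x = (if i = j then - cos (x $ j) else 0)" for i x
  proof -
    have "pd [i] (\<lambda>x::real^'n. (if i = j then - 1 else 0) * sin (x $ j)) x
       = (if i = j then - 1 else 0) * pd [i] (\<lambda>x. sin (x $ j)) x"
      by (subst pd_mult) (simp_all add: differentiable_cos_coord)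
    then show ?thesis by (simp add: pd_Cons [of i "[i]"] pd_cos_coord)
  qed
  then show ?thesis
    by (simp add: helmholtz_def smooth_on_cos_coord lap_def)
qed

lemma helmholtz_add_cmult:
  assumes "helmholtz f" "helmholtz g"
  shows "helmholtz (\<lambda>x. f x + c * g x)"
proof -
  have f: "smooth_on UNIV f" and g: "smooth_on UNIV g"
    using assms by (auto simp: helmholtz_def)
  have cg: "smooth_on UNIV (\<lambda>x. c * g x)"
    by (intro smooth_on_mult smooth_on_const g open_UNIV)
  have "pd is (\<lambda>x. c * g x) x = c * pd is g x" for "is" x
    using pd_list_compose_linear [OF bounded_linear_mult_right open_UNIV g UNIV_I] .
  then have "lap (\<lambda>x. f x + c * g x) x = lap f x + c * lap g x" for x
    by (simp add: lap_def pd_list_add [OF open_UNIV f cg UNIV_I] sum.distrib sum_distrib_left)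
  then show ?thesis
    using assms by (simp add: helmholtz_def smooth_on_add f cg)
qed

section \<open>Assembly of the vector-valued eigenfunction\<close>

theorem theorem2p1:
  fixes p0 :: "real^'k::finite"
    and L :: "real^'n::finite \<Rightarrow> real^'k"
    and \<phi> :: "real^'n \<Rightarrow> real^'m::finite"
    and r :: nat and \<delta>' :: real
  assumes "CARD('n) \<ge> 2" and "CARD('k) = CARD('n) + 1"
    and "normal_coord_frame p0 L"
    and "smooth_on UNIV \<phi>"
    and "\<forall>x. lap \<phi> x + \<phi> x = 0"
    and "r > 0" and "\<delta>' > 0"
  shows "\<forall>\<^sub>F N in sequentially. \<exists>\<psi> :: real^'k \<Rightarrow> real^'m.
           sphere_eigenfunction \<psi> (real N * (real N + real CARD('n) - 1)) \<and>
           Cr_norm r (ball 0 1)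
             (\<lambda>x. \<phi> x - \<psi> (normal_coord_inv p0 L (x /\<^sub>R real N))) \<le> \<delta>'"
proof -
  note frame = \<open>normal_coord_frame p0 L\<close>
  let ?m = "real CARD('m)"
  have m: "?m > 0" by simp
  have \<phi>: "helmholtz (\<lambda>x. \<phi> x $ j)" for j
  proof -
    have "lap (\<lambda>x. \<phi> x $ j) x = lap \<phi> x $ j" for x
      using lap_vec_nth [OF open_UNIV assms(4) UNIV_I] by simp
    moreover have "lap \<phi> x = - \<phi> x" for x
      using assms(5) by (simp add: eq_neg_iff_add_eq_0)
    ultimately show ?thesis
      using smooth_on_compose_linear [OF bounded_linear_vec_nth open_UNIV assms(4)]
      by (simp add: helmholtz_def)
  qed
  obtain i0 :: 'n where True by simp
  define g where "g = (\<lambda>x::real^'n. cos (x $ i0))"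
  have g: "helmholtz g" unfolding g_def by (rule helmholtz_cos_coord)
  obtain K where K: "K \<ge> 0" "Cr_le (ball 0 1) r g K"
  proof -
    \<comment> \<open>The remainder of order 0 is g itself, so the remainder estimate at N = 0
      bounds g in C^r.\<close>
    obtain K where "Cr_le (ball 0 1) r (taylor_rem 0 g) (K / 4 ^ 0)"
      using Cr_le_taylor_rem [OF g] by blast
    moreover have "taylor_rem 0 g = g" by (auto simp: taylor_rem_def)
    ultimately show ?thesis using that [of K] Cr_le_nonneg by auto
  qed
  \<comment> \<open>The norm of a vector is bounded by the sum over its m components, so each
    component may err by \<delta>'/m.\<close>
  define \<eta> where "\<eta> = \<delta>' / ?m"
  have "\<eta> > 0" using \<open>\<delta>' > 0\<close> m by (simp add: \<eta>_def)
  \<comment> \<open>The perturbation costs at most e K \<le> \<eta>/2 in C^r; K + 1 keeps the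
    denominator positive when K = 0. As cos 0 = 1, it moves every component of the value at the
    origin by e.\<close>
  define e where "e = (if \<phi> 0 = 0 then \<eta> / (2 * (K + 1)) else 0)"
  have e: "e \<ge> 0" "e * K \<le> \<eta> / 2" "\<phi> 0 = 0 \<Longrightarrow> e > 0"
    using \<open>\<eta> > 0\<close> K(1) by (auto simp: e_def field_simps)
  define u where "u = (\<lambda>j x. \<phi> x $ j + e * g x)"
  have u: "helmholtz (u j)" for j
    unfolding u_def by (rule helmholtz_add_cmult [OF \<phi> g])
  have "\<exists>j. u j 0 \<noteq> 0"
  proof (cases "\<phi> 0 = 0")
    case True
    then show ?thesis using e(3) by (simp add: u_def g_def)
  next
    case False
    then show ?thesis by (auto simp: u_def e_def vec_eq_iff)
  qed
  then obtain j0 where j0: "u j0 0 \<noteq> 0" by blast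
  have "\<forall>\<^sub>F N in sequentially. \<forall>j. Cr_le (ball 0 1) r (\<lambda>x. u j x - chart_harmonic N (u j) x) (\<eta> / 2)"
    using \<open>\<eta> > 0\<close> by (intro eventually_all_finite Cr_le_chart_harmonic u) simp
  with eventually_gt_at_top [of 0] show ?thesis
  proof eventually_elim
    case (elim N)
    define H where "H = (\<lambda>j. sphere_harmonic N p0 L (u j))"
    define \<psi> :: "real^'k \<Rightarrow> real^'m" where "\<psi> = (\<lambda>p. \<chi> j. H j p)"
    have ext_\<psi>: "sphere_ext \<psi> = (\<lambda>x. \<chi> j. sphere_ext (H j) x)"
      by (auto simp: \<psi>_def sphere_ext_def)
    have sm: "smooth_on (UNIV - {0}) (sphere_ext \<psi>)"
      unfolding ext_\<psi> H_def by (intro smooth_on_vec open_punctured smooth_on_sphere_ext [OF frame u])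
    have eig: "sphere_lap \<psi> p = - (real N * (real N + real CARD('n) - 1)) *\<^sub>R \<psi> p" if "p \<in> sphere 0 1" for p
    proof -
      have "p \<in> UNIV - {0}" "norm p = 1" using that by auto
      have "sphere_lap \<psi> p $ j = (- (real N * (real N + real CARD('n) - 1)) *\<^sub>R \<psi> p) $ j" for j
      proof -
        have "sphere_lap \<psi> p $ j = sphere_lap (H j) p"
          unfolding sphere_lap_def using lap_vec_nth [OF open_punctured sm \<open>p \<in> UNIV - {0}\<close>, of j]
          by (simp add: ext_\<psi>)
        \<comment> \<open>The ambient dimension n + 1 turns N + \<open>CARD('k)\<close> - 2 into N +
          n - 1.\<close>
        then show ?thesis
          using sphere_lap_sphere_harmonic [OF frame u \<open>norm p = 1\<close>, of N j] assms(2)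
          by (simp add: H_def \<psi>_def algebra_simps)
      qed
      then show ?thesis by (simp add: vec_eq_iff)
    qed
    have "\<psi> p0 $ j0 \<noteq> 0"
      using j0 by (simp add: \<psi>_def H_def sphere_harmonic_p0 [OF frame])
    moreover have "p0 \<in> sphere 0 1"
      using frame by (simp add: normal_coord_frame_def)
    ultimately have "\<exists>p\<in>sphere 0 1. \<psi> p \<noteq> 0"
      by (metis zero_index)
    with sm eig have "sphere_eigenfunction \<psi> (real N * (real N + real CARD('n) - 1))"
      by (simp add: sphere_eigenfunction_def)
    moreover have "Cr_norm r (ball 0 1) (\<lambda>x. \<phi> x - \<psi> (normal_coord_inv p0 L (x /\<^sub>R real N))) \<le> \<delta>'"
    proof -
      let ?D = "\<lambda>x. \<phi> x - \<psi> (normal_coord_inv p0 L (x /\<^sub>R real N))"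
      define d where "d = (\<lambda>j x. \<phi> x $ j - chart_harmonic N (u j) x)"
      have D: "?D = (\<lambda>x. \<chi> j. d j x)"
        by (rule ext) (simp add: d_def \<psi>_def H_def vec_eq_iff sphere_harmonic_chart [OF frame elim(1)])
      have "smooth_on (ball 0 1) (\<lambda>x. \<phi> x $ j)" for j
        using \<phi> [of j] smooth_on_subset [OF _ subset_UNIV] unfolding helmholtz_def by blast
      then have "smooth_on (ball 0 1) (d j)" for j
        unfolding d_def by (intro smooth_on_diff smooth_on_chart_harmonic elim(1) open_ball)
      then have smD: "smooth_on (ball 0 1) (\<lambda>x. (\<chi> j. d j x) :: real^'m)"
        by (intro smooth_on_vec open_ball)
      have d: "Cr_le (ball 0 1) r (d j) \<eta>" for j
      proof -
        \<comment> \<open>One half of \<eta> pays for the convergence to the perturbed solution u j,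
          the other half for undoing the perturbation.\<close>
        have "Cr_le (ball 0 1) r (\<lambda>x. (u j x - chart_harmonic N (u j) x) - e * g x) (\<eta> / 2 + \<bar>e\<bar> * K)"
          using elim(2) by (intro Cr_le_diff Cr_le_cmult K open_ball) auto
        moreover have "\<eta> / 2 + \<bar>e\<bar> * K \<le> \<eta>"
          using e by simp
        ultimately show ?thesis
          unfolding d_def by (auto simp: u_def intro: Cr_le_mono)
      qed
      have le: "norm (pd is ?D x) \<le> \<delta>'" if "length is \<le> r" "x \<in> ball 0 1" for "is" x
      proof -
        have "norm (pd is ?D x) \<le> (\<Sum>j\<in>UNIV. \<bar>pd is ?D x $ j\<bar>)"
          by (rule norm_le_l1_cart)
        also have "\<dots> \<le> (\<Sum>j\<in>(UNIV::'m set). \<eta>)"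
          unfolding D pd_vec_nth [OF open_ball smD that(2)]
          using Cr_le_pd [OF d that] by (intro sum_mono) simp
        also have "\<dots> = \<delta>'"
          using m by (simp add: \<eta>_def)
        finally show ?thesis .
      qed
      show ?thesis
        unfolding Cr_norm_def
      \<comment> \<open>A least-upper-bound argument in a conditionally complete order: besides the
        pointwise bound, the index set must be seen to be nonempty.\<close>
      proof (rule cSUP_least)
        have "([], 0) \<in> {is :: 'n list. length is \<le> r} \<times> ball 0 (1::real)" by simp
        then show "{is :: 'n list. length is \<le> r} \<times> (ball 0 1 :: (real^'n) set) \<noteq> {}" by blast
      qed (use le in auto)
    qed
    ultimately show ?case by blast
  qed
qed

end
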